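(* Let $(\mathcal S^k,\rho_k,\mathbf P)_{1\le k\le n}$ be a family of metric probability spaces that is $\Psi$-dominated with respect to a positive Borel measure $\mu$ on $\mathcal S$, where $\mathbf P\ll\mu^n$. Then for any $f:\mathcal S^n\to\mathbb R$ that is Lipschitz with respect to $\rho_n$, with Lipschitz constant $\|f\|_{\mathrm{Lip}}$, we have for all $t>0$ $$\mathbf P\{|f-\mathbf E f|>t\}\le 2\exp\left(-\frac{t^2}{2n\,\|f\|_{\mathrm{Lip}}^2\,\|\Delta_n\|_\infty^2}\right).$$
   Context: Probability measures: for each $k$, $\mathbf P$ on $\mathcal S^k$ is a probability measure on the Borel $\sigma$-algebra of $\rho_k$, and these measures (all denoted $\mathbf P$) are consistent: the measure on $\mathcal S^{k-1}$ is the marginal of the measure on $\mathcal S^{k}$ on the first $k-1$ coordinates. $X=(X_1,\dots,X_n)$ denotes the canonical $\mathcal S$-valued process with law $\mathbf P$ on $\mathcal S^n$, and $\mathbf E$ is expectation under $\mathbf P$. $\mathbf P$ has a density $p$ with respect to $\mu^n=\mu\otimes\cdots\otimes\mu$, i.e. $d\mathbf P(x)=p(x)\,d\mu^n(x)$, and conditional laws are given by the corresponding conditional densities. The matrix $\Delta_n$: for $1\le i<j\le n$, $y\in\mathcal S^{i-1}$, $w,w'\in\mathcal S$, let $$\eta_{ij}(y,w,w')=\big\|\mathcal L(X_j,\dots,X_n\mid (X_1,\dots,X_i)=yw)-\mathcal L(X_j,\dots,X_n\mid (X_1,\dots,X_i)=yw')\big\|_{TV},$$ where $\mathcal L(\cdot\mid\cdot)$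 is the conditional law, $yw$ is concatenation, and $\|\tau\|_{TV}=\frac12\sup\sum_i|\tau(E_i)|$, the supremum being over countable partitions $\{E_i\}$ of the space. Let $\bar\eta_{ij}=\operatorname{ess\,sup}_{y\in\mathcal S^{i-1},\,w,w'\in\mathcal S}\eta_{ij}(y,w,w')$, where the essential supremum is taken with respect to the measure $\mathbf P$ on $\mathcal S^i$ (the essential supremum of a nonnegative function is the smallest $a\in[0,\infty]$ that bounds it $\mathbf P$-almost surely). $\Delta_n$ is the upper-triangular $n\times n$ matrix with $(\Delta_n)_{ii}=1$ and $(\Delta_n)_{ij}=\bar\eta_{ij}$ for $i<j$; $\|\Delta_n\|_\infty$ is its $\ell_\infty$ operator norm, $\max_{1\le i<n}(1+\bar\eta_{i,i+1}+\dots+\bar\eta_{i,n})$. Lipschitz functions: $\|f\|_{\mathrm{Lip}}$ is the smallest $C$ with $|f(x)-f(y)|\le C\rho_n(x,y)$ for all $x,y$. For a metric space $(\mathcal X,\rho)$ with $\operatorname{diam}_\rho(\mathcal X)=\sup_{x,y}\rho(x,y)$, $\operatorname{Lip}(\mathcal X,\rho)$ is the set of $g:\mathcal X\to[0,\operatorname{diam}_\rho(\mathcal X)]$ with $|g(x)-g(y)|\le\rho(x,y)$ for all $x,y$. The functional $\Psi_k$: let $(z)_+=\max(z,0)$. For $f\in L_1(\mathcal S^k,\mu^k)$ put $(\pi f)(x_2,\dots,x_k)=\int_{\mathcal S}f(x_1,x_2,\dots,x_k)\,d\mu(x_1)$. Define $\Psi_0=0$ and $\Psi_k(f)=\int_{\mathcal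 S^k}(f)_+\,d\mu^k+\Psi_{k-1}(\pi f)$ for $k\ge1$. $\Psi$-dominance: the family $(\mathcal S^k,\rho_k)$ is $\Psi$-dominated with respect to $\mu$ if (i) for all $k$, all $1\le i\le k$ and all $x,y\in\mathcal S^k$ with $x_i=y_i$, $\rho_k(x,y)=\rho_{k-1}(x',y')$, where $x',y'\in\mathcal S^{k-1}$ are obtained from $x,y$ by deleting the $i$th coordinate (for $k=1$ this is void); (ii) for each $k$, $\mu^k=\mu\otimes\cdots\otimes\mu$ is a positive product measure on the Borel $\sigma$-algebra induced by $\rho_k$; and (iii) $\sup_{g\in\operatorname{Lip}(\mathcal S^k,\rho_k)}\int_{\mathcal S^k}fg\,d\mu^k\le\Psi_k(f)$ for every $k$ and every $f\in L_1(\mathcal S^k,\mu^k)$. *)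

theory Defs
  imports "HOL-Probability.Probability"
begin

text \<open>A point \<open>(x\<^sub>1, \<dots>, x\<^sub>k)\<close> of \<open>S\<^sup>k\<close> is an extensional function on the index set \<open>{1..k}\<close>, and
  \<open>\<mu>\<^sup>k\<close> is the library product measure on these functions.\<close>

abbreviation Spow :: "'a set \<Rightarrow> nat \<Rightarrow> (nat \<Rightarrow> 'a) set" where
  "Spow S k \<equiv> {1..k} \<rightarrow>\<^sub>E S"

abbreviation prodM :: "'a measure \<Rightarrow> nat set \<Rightarrow> (nat \<Rightarrow> 'a) measure" where
  "prodM \<mu> I \<equiv> PiM I (\<lambda>_. \<mu>)"

definition del_coord :: "nat \<Rightarrow> nat \<Rightarrow> (nat \<Rightarrow> 'a) \<Rightarrow> (nat \<Rightarrow> 'a)" where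
  "del_coord k i x = (\<lambda>m\<in>{1..k - 1}. if m < i then x m else x (Suc m))"

definition cons_coord :: "nat \<Rightarrow> 'a \<Rightarrow> (nat \<Rightarrow> 'a) \<Rightarrow> (nat \<Rightarrow> 'a)" where
  "cons_coord k s x = (\<lambda>m\<in>{1..k}. if m = 1 then s else x (m - 1))"

definition metric_borel :: "'b set \<Rightarrow> ('b \<Rightarrow> 'b \<Rightarrow> real) \<Rightarrow> 'b measure" where
  "metric_borel X d = sigma X {U. openin (Metric_space.mtopology X d) U}"

definition metric_prob_family ::
  "nat \<Rightarrow> 'a set \<Rightarrow> (nat \<Rightarrow> (nat \<Rightarrow> 'a) \<Rightarrow> (nat \<Rightarrow> 'a) \<Rightarrow> real) \<Rightarrow> (nat \<Rightarrow> (nat \<Rightarrow> 'a) measure) \<Rightarrow> bool"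
where
  "metric_prob_family n S \<rho> P \<longleftrightarrow>
     (\<forall>k\<in>{1..n}. Metric_space (Spow S k) (\<rho> k) \<and> prob_space (P k) \<and>
        space (P k) = Spow S k \<and> sets (P k) = sets (metric_borel (Spow S k) (\<rho> k))) \<and>
     (\<forall>k\<in>{2..n}. P (k - 1) = distr (P k) (P (k - 1)) (\<lambda>x. restrict x {1..k - 1}))"


subsection \<open>Lipschitz functions\<close>

definition lip_bounds :: "'b set \<Rightarrow> ('b \<Rightarrow> 'b \<Rightarrow> real) \<Rightarrow> ('b \<Rightarrow> real) \<Rightarrow> real set" where
  "lip_bounds X d f = {C. 0 \<le> C \<and> (\<forall>x\<in>X. \<forall>y\<in>X. \<bar>f x - f y\<bar> \<le> C * d x y)}"

definition is_lipschitz :: "'b set \<Rightarrow> ('b \<Rightarrow> 'b \<Rightarrow> real) \<Rightarrow> ('b \<Rightarrow> real) \<Rightarrow> bool" where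
  "is_lipschitz X d f \<longleftrightarrow> lip_bounds X d f \<noteq> {}"

text \<open>Constants \<open>C\<close> are nonnegative, so that the norm is \<open>0\<close> also when \<open>X\<close> is a single point.\<close>

definition lip_norm :: "'b set \<Rightarrow> ('b \<Rightarrow> 'b \<Rightarrow> real) \<Rightarrow> ('b \<Rightarrow> real) \<Rightarrow> real" where
  "lip_norm X d f = Inf (lip_bounds X d f)"

text \<open>The diameter may be infinite, hence \<open>ereal\<close>.\<close>

definition ediam :: "'b set \<Rightarrow> ('b \<Rightarrow> 'b \<Rightarrow> real) \<Rightarrow> ereal" where
  "ediam X d = (SUP (x, y)\<in>X \<times> X. ereal (d x y))"

definition Lip :: "'b set \<Rightarrow> ('b \<Rightarrow> 'b \<Rightarrow> real) \<Rightarrow> ('b \<Rightarrow> real) set" where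
  "Lip X d = {g. (\<forall>x\<in>X. 0 \<le> g x \<and> ereal (g x) \<le> ediam X d) \<and>
                 (\<forall>x\<in>X. \<forall>y\<in>X. \<bar>g x - g y\<bar> \<le> d x y)}"


subsection \<open>The functional \<open>\<Psi>\<close> and \<open>\<Psi>\<close>-dominance\<close>

text \<open>\<open>marg1 \<mu> k f\<close> is the function \<open>\<pi> f\<close> for \<open>f\<close> on \<open>S\<^sup>k\<close>; its argument \<open>(x\<^sub>2, \<dots>, x\<^sub>k)\<close> is
  reindexed by \<open>{1..k - 1}\<close>, so that it is a function on \<open>S\<^sup>k\<^sup>-\<^sup>1\<close>.\<close>

definition marg1 :: "'a measure \<Rightarrow> nat \<Rightarrow> ((nat \<Rightarrow> 'a) \<Rightarrow> real) \<Rightarrow> (nat \<Rightarrow> 'a) \<Rightarrow> real" where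
  "marg1 \<mu> k f x = (\<integral>s. f (cons_coord k s x) \<partial>\<mu>)"

primrec Psi :: "'a measure \<Rightarrow> nat \<Rightarrow> ((nat \<Rightarrow> 'a) \<Rightarrow> real) \<Rightarrow> real" where
  "Psi \<mu> 0 = (\<lambda>f. 0)"
| "Psi \<mu> (Suc k) = (\<lambda>f. (\<integral>x. max (f x) 0 \<partial>prodM \<mu> {1..Suc k}) + Psi \<mu> k (marg1 \<mu> (Suc k) f))"

text \<open>The second clause says that the product \<open>\<sigma>\<close>-algebra, on which \<open>\<mu>\<^sup>k\<close> lives, is the Borel
  \<open>\<sigma>\<close>-algebra of \<open>\<rho>\<^sub>k\<close>; for \<open>k = 1\<close> it says that \<open>\<mu>\<close> is a Borel measure on \<open>S\<close>.\<close>

definition Psi_dominated ::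
  "nat \<Rightarrow> 'a set \<Rightarrow> (nat \<Rightarrow> (nat \<Rightarrow> 'a) \<Rightarrow> (nat \<Rightarrow> 'a) \<Rightarrow> real) \<Rightarrow> 'a measure \<Rightarrow> bool"
where
  "Psi_dominated n S \<rho> \<mu> \<longleftrightarrow>
     (\<forall>k\<in>{2..n}. \<forall>i\<in>{1..k}. \<forall>x\<in>Spow S k. \<forall>y\<in>Spow S k. x i = y i \<longrightarrow>
        \<rho> k x y = \<rho> (k - 1) (del_coord k i x) (del_coord k i y)) \<and>
     (\<forall>k\<in>{1..n}. sets (prodM \<mu> {1..k}) = sets (metric_borel (Spow S k) (\<rho> k))) \<and>
     (\<forall>k\<in>{1..n}. \<forall>f. integrable (prodM \<mu> {1..k}) f \<longrightarrow>
        (SUP g\<in>Lip (Spow S k) (\<rho> k). ereal (\<integral>x. f x * g x \<partial>prodM \<mu> {1..k})) \<le> ereal (Psi \<mu> k f))"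


subsection \<open>Conditional laws and the mixing matrix\<close>

definition marg_density :: "'a measure \<Rightarrow> ((nat \<Rightarrow> 'a) \<Rightarrow> ennreal) \<Rightarrow> nat \<Rightarrow> nat \<Rightarrow> (nat \<Rightarrow> 'a) \<Rightarrow> ennreal"
where
  "marg_density \<mu> p n i z = (\<integral>\<^sup>+ x. p (merge {1..i} {i+1..n} (z, x)) \<partial>prodM \<mu> {i+1..n})"

text \<open>The law of \<open>(X\<^sub>j, \<dots>, X\<^sub>n)\<close> given \<open>(X\<^sub>1, \<dots>, X\<^sub>i) = z\<close>, where \<open>i < j\<close>: the marginal on the
  coordinates \<open>{j..n}\<close> of the law of \<open>(X\<^sub>i\<^sub>+\<^sub>1, \<dots>, X\<^sub>n)\<close> with the conditional density.  Points \<open>z\<close>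
  with marginal density \<open>0\<close> or \<open>\<infinity>\<close>, where this is the null measure, form a null set.\<close>

definition cond_law ::
  "'a measure \<Rightarrow> ((nat \<Rightarrow> 'a) \<Rightarrow> ennreal) \<Rightarrow> nat \<Rightarrow> nat \<Rightarrow> nat \<Rightarrow> (nat \<Rightarrow> 'a) \<Rightarrow> (nat \<Rightarrow> 'a) measure"
where
  "cond_law \<mu> p n i j z =
     distr (density (prodM \<mu> {i+1..n})
              (\<lambda>x. p (merge {1..i} {i+1..n} (z, x)) / marg_density \<mu> p n i z))
           (prodM \<mu> {j..n}) (\<lambda>x. restrict x {j..n})"

text \<open>Countable partitions are indexed by \<open>nat\<close>; empty members are allowed, which covers the
  finite ones.\<close>

definition tv_norm :: "'b measure \<Rightarrow> ('b set \<Rightarrow> real) \<Rightarrow> ennreal" where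
  "tv_norm M \<tau> =
     (SUP E\<in>{E :: nat \<Rightarrow> 'b set. range E \<subseteq> sets M \<and> disjoint_family E \<and> (\<Union>i. E i) = space M}.
        \<Sum>i. ennreal \<bar>\<tau> (E i)\<bar>) / 2"

definition eta ::
  "'a measure \<Rightarrow> ((nat \<Rightarrow> 'a) \<Rightarrow> ennreal) \<Rightarrow> nat \<Rightarrow> nat \<Rightarrow> nat \<Rightarrow> (nat \<Rightarrow> 'a) \<Rightarrow> 'a \<Rightarrow> 'a \<Rightarrow> ennreal"
where
  "eta \<mu> p n i j y w w' =
     tv_norm (prodM \<mu> {j..n})
       (\<lambda>A. measure (cond_law \<mu> p n i j (y(i := w))) A - measure (cond_law \<mu> p n i j (y(i := w'))) A)"

text \<open>The exceptional set of the essential supremum is a null set of the measure \<open>P i\<close> on \<open>S\<^sup>i\<close>,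
  which both concatenations \<open>yw\<close> and \<open>yw'\<close> have to avoid.\<close>

definition eta_bar ::
  "'a set \<Rightarrow> (nat \<Rightarrow> (nat \<Rightarrow> 'a) measure) \<Rightarrow> 'a measure \<Rightarrow> ((nat \<Rightarrow> 'a) \<Rightarrow> ennreal) \<Rightarrow> nat \<Rightarrow> nat \<Rightarrow> nat \<Rightarrow> ennreal"
where
  "eta_bar S P \<mu> p n i j =
     Inf {a. \<exists>N\<in>null_sets (P i). \<forall>y\<in>Spow S (i - 1). \<forall>w\<in>S. \<forall>w'\<in>S.
               y(i := w) \<notin> N \<and> y(i := w') \<notin> N \<longrightarrow> eta \<mu> p n i j y w w' \<le> a}"

text \<open>The conversion to \<open>real\<close> loses nothing, as \<open>eta\<close> never exceeds \<open>1\<close>.\<close>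

definition Delta ::
  "'a set \<Rightarrow> (nat \<Rightarrow> (nat \<Rightarrow> 'a) measure) \<Rightarrow> 'a measure \<Rightarrow> ((nat \<Rightarrow> 'a) \<Rightarrow> ennreal) \<Rightarrow> nat \<Rightarrow> nat \<Rightarrow> nat \<Rightarrow> real"
where
  "Delta S P \<mu> p n i j =
     (if i = j then 1 else if i < j then enn2real (eta_bar S P \<mu> p n i j) else 0)"

definition linf_opnorm :: "nat \<Rightarrow> (nat \<Rightarrow> nat \<Rightarrow> real) \<Rightarrow> real" where
  "linf_opnorm n A =
     (SUP x\<in>{x. \<forall>j\<in>{1..n}. \<bar>x j\<bar> \<le> 1}. MAX i\<in>{1..n}. \<bar>\<Sum>j\<in>{1..n}. A i j * x j\<bar>)"

lemma linf_opnorm_eq_Max_row_sum: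
  assumes "1 \<le> n"
  shows "linf_opnorm n A = (MAX i\<in>{1..n}. \<Sum>j\<in>{1..n}. \<bar>A i j\<bar>)"
proof -
  let ?B = "{x. \<forall>j\<in>{1..n}. \<bar>x j\<bar> \<le> (1::real)}"
  let ?F = "\<lambda>x. MAX i\<in>{1..n}. \<bar>\<Sum>j\<in>{1..n}. A i j * x j\<bar>"
  let ?R = "\<lambda>i. \<Sum>j\<in>{1..n}. \<bar>A i j\<bar>"
  have ne: "{1..n} \<noteq> {}" using assms by auto
  have row: "\<bar>\<Sum>j\<in>{1..n}. A i j * x j\<bar> \<le> ?R i" if "x \<in> ?B" for x i
  proof -
    have "\<bar>\<Sum>j\<in>{1..n}. A i j * x j\<bar> \<le> (\<Sum>j\<in>{1..n}. \<bar>A i j * x j\<bar>)" by (rule sum_abs)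
    also have "\<dots> \<le> ?R i"
      using that by (intro sum_mono) (auto simp: abs_mult intro!: mult_left_le)
    finally show ?thesis .
  qed
  have le: "?F x \<le> Max (?R ` {1..n})" if "x \<in> ?B" for x
  proof (rule Max.boundedI)
    fix a assume "a \<in> (\<lambda>i. \<bar>\<Sum>j\<in>{1..n}. A i j * x j\<bar>) ` {1..n}"
    then obtain i where i: "i \<in> {1..n}" and a: "a = \<bar>\<Sum>j\<in>{1..n}. A i j * x j\<bar>" by blast
    have "?R i \<le> Max (?R ` {1..n})" by (rule Max_ge[OF finite_imageI[OF finite_atLeastAtMost] imageI[OF i]])
    then show "a \<le> Max (?R ` {1..n})" using row[OF that, of i] unfolding a by linarith
  qed (use ne in simp_all)
  obtain i where i: "i \<in> {1..n}" "Max (?R ` {1..n}) = ?R i"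
  proof -
    have "Max (?R ` {1..n}) \<in> ?R ` {1..n}" by (rule Max_in) (use ne in simp_all)
    then show ?thesis using that by blast
  qed
  let ?x = "\<lambda>j. sgn (A i j)"
  have x: "?x \<in> ?B" by (auto simp: sgn_real_def)
  have "?R i = (\<Sum>j\<in>{1..n}. A i j * ?x j)" by (simp only: abs_sgn)
  also have "\<dots> \<le> \<bar>\<Sum>j\<in>{1..n}. A i j * ?x j\<bar>" by (rule abs_ge_self)
  also have "\<dots> \<le> ?F ?x"
    by (rule Max_ge[OF finite_imageI[OF finite_atLeastAtMost] imageI[OF i(1)]])
  finally have ge: "Max (?R ` {1..n}) \<le> ?F ?x" using i(2) by simp
  have eq: "?F ?x = Max (?R ` {1..n})" using ge le[OF x] by linarith
  show ?thesis unfolding linf_opnorm_def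
  proof (rule cSup_eq_maximum)
    show "Max (?R ` {1..n}) \<in> ?F ` ?B" using imageI[OF x, of ?F] by (simp only: eq)
    show "y \<le> Max (?R ` {1..n})" if "y \<in> ?F ` ?B" for y using that le by auto
  qed
qed

lemma linf_opnorm_Delta:
  assumes "2 \<le> n"
  shows "linf_opnorm n (Delta S P \<mu> p n) =
    (MAX i\<in>{1..<n}. 1 + (\<Sum>j\<in>{i+1..n}. enn2real (eta_bar S P \<mu> p n i j)))"
proof -
  let ?r = "\<lambda>i. 1 + (\<Sum>j\<in>{i+1..n}. enn2real (eta_bar S P \<mu> p n i j))"
  have row: "(\<Sum>j\<in>{1..n}. \<bar>Delta S P \<mu> p n i j\<bar>) = ?r i" if "i \<in> {1..n}" for i
  proof -
    have split: "{1..n} = {1..<i} \<union> {i..n}" using that by auto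
    have "(\<Sum>j\<in>{1..n}. \<bar>Delta S P \<mu> p n i j\<bar>) =
        (\<Sum>j\<in>{1..<i}. \<bar>Delta S P \<mu> p n i j\<bar>) + (\<Sum>j\<in>{i..n}. \<bar>Delta S P \<mu> p n i j\<bar>)"
      unfolding split by (rule sum.union_disjoint) auto
    also have "(\<Sum>j\<in>{1..<i}. \<bar>Delta S P \<mu> p n i j\<bar>) = 0"
      by (intro sum.neutral) (auto simp: Delta_def)
    also have "(\<Sum>j\<in>{i..n}. \<bar>Delta S P \<mu> p n i j\<bar>) =
        \<bar>Delta S P \<mu> p n i i\<bar> + (\<Sum>j\<in>{i+1..n}. \<bar>Delta S P \<mu> p n i j\<bar>)"
      using that by (simp add: sum.atLeast_Suc_atMost)
    also have "(\<Sum>j\<in>{i+1..n}. \<bar>Delta S P \<mu> p n i j\<bar>) =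
        (\<Sum>j\<in>{i+1..n}. enn2real (eta_bar S P \<mu> p n i j))"
      by (intro sum.cong) (auto simp: Delta_def)
    finally show ?thesis by (simp add: Delta_def)
  qed
  have "linf_opnorm n (Delta S P \<mu> p n) = Max (?r ` {1..n})"
  proof -
    have "(\<lambda>i. \<Sum>j\<in>{1..n}. \<bar>Delta S P \<mu> p n i j\<bar>) ` {1..n} = ?r ` {1..n}"
      by (rule image_cong[OF refl row])
    moreover have "1 \<le> n" using assms by simp
    ultimately show ?thesis by (simp only: linf_opnorm_eq_Max_row_sum)
  qed
  also have "?r ` {1..n} = insert (?r n) (?r ` {1..<n})"
  proof -
    have "{1..n} = insert n {1..<n}" using assms by auto
    then show ?thesis by (simp only: image_insert)
  qed
  also have "Max \<dots> = max (?r n) (Max (?r ` {1..<n}))"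
    using assms by (intro Max_insert) auto
  also have "\<dots> = Max (?r ` {1..<n})"
  proof (rule max_absorb2)
    have "?r n \<le> ?r 1" by (simp add: sum_nonneg)
    also have "\<dots> \<le> Max (?r ` {1..<n})" using assms by (intro Max_ge) auto
    finally show "?r n \<le> Max (?r ` {1..<n})" .
  qed
  finally show ?thesis .
qed

end

theory Submission
  imports Defs
begin

text \<open>
  The proof is the martingale method.  Let \<open>F\<^sub>i(z)\<close> be the conditional mean of \<open>f\<close> given
  \<open>(X\<^sub>1, \<dots>, X\<^sub>i) = z\<close>.  If, for fixed \<open>y\<close>, the values \<open>F\<^sub>i(yw)\<close> vary by at most \<open>c\<close> as \<open>w\<close> ranges over
  \<open>S\<close>, up to a null set of prefixes, then averaging over \<open>w\<close> with Hoeffding's lemma gives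
  \<open>E exp(\<lambda> F\<^sub>i) \<le> exp(\<lambda>\<^sup>2 c\<^sup>2 / 2) E exp(\<lambda> F\<^sub>i\<^sub>-\<^sub>1)\<close> (\<open>mgf_step\<close>).  Iterating from \<open>F\<^sub>n = f\<close> down to
  \<open>F\<^sub>0 = E f\<close> shows that \<open>f - E f\<close> is subgaussian with variance proxy \<open>n c\<^sup>2\<close> (\<open>mgf_bound\<close>), and the
  exponential Markov inequality turns this into the tail bound (\<open>subgaussian_tail\<close>).

  What is left is \<open>c = L \<parallel>\<Delta>\<^sub>n\<parallel>\<^sub>\<infinity>\<close>, where \<open>L\<close> is the Lipschitz constant (\<open>oscillation\<close>).  With the conditional
  densities \<open>q\<close> and \<open>q'\<close> given \<open>yw\<close> and \<open>yw'\<close>,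
  \<open>F\<^sub>i(yw) - F\<^sub>i(yw') = \<integral> (q - q')(x) f(ywx) dx + \<integral> q'(x) (f(ywx) - f(yw'x)) dx\<close>.
  The points \<open>ywx\<close> and \<open>yw'x\<close> differ in one coordinate.  Deleting the common coordinates leaves two points
  of \<open>S\<close>, and \<open>\<Psi>\<close>-dominance for \<open>k = 1\<close>, tested on constant functions, forces \<open>diam S \<le> 1\<close>
  (\<open>diam_le_1\<close>); so the second integral is at most \<open>L\<close>.  For the first, deleting the common
  prefix shows that \<open>f(yw\<cdot>)\<close> is \<open>L\<close>-Lipschitz for \<open>\<rho>\<^sub>n\<^sub>-\<^sub>i\<close>; since \<open>q - q'\<close> has integral \<open>0\<close>, the function may
  be shifted by a constant and scaled into \<open>Lip\<close>, and \<open>\<Psi>\<close>-dominance for \<open>k = n - i\<close> bounds the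
  integral by \<open>L \<Psi>\<^sub>n\<^sub>-\<^sub>i(q - q')\<close>.  Unfolding \<open>\<Psi>\<close>, its summands are the integrals of the positive parts of
  the successive marginals of \<open>q - q'\<close>, and each is the difference of the two conditional laws of
  \<open>(X\<^sub>j, \<dots>, X\<^sub>n)\<close> on one event, hence at most \<open>\<eta>\<^sub>i\<^sub>j\<close> (\<open>Psi_le_sum\<close>, \<open>tail_variation\<close>).

  All conditional objects are explicit functions built from the density \<open>p\<close>, so that no abstract
  conditional expectations occur, and after adding a constant to \<open>f\<close> its conditional means are
  quotients of nonnegative integrals, to which Tonelli's theorem applies without integrability conditions.
\<close>

text \<open>Index sets are written \<open>{1..k}\<close> throughout; the simplifier should leave the \<open>1\<close> alone.\<close>

declare One_nat_def [simp del]

section \<open>Coordinate changes in product measures\<close>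

text \<open>The factors \<open>a + 1, \<dots>, a + k\<close> of a point, renumbered to be a point of \<open>S\<^sup>k\<close>.\<close>

definition window :: "nat \<Rightarrow> nat \<Rightarrow> (nat \<Rightarrow> 'a) \<Rightarrow> (nat \<Rightarrow> 'a)" where
  "window a k x = (\<lambda>m\<in>{1..k}. x (m + a))"

lemma window_measurable [measurable]:
  assumes "{a + 1..a + k} \<subseteq> I"
  shows "window a k \<in> measurable (prodM \<mu> I) (prodM \<mu> {1..k})"
  unfolding window_def
proof (rule measurable_restrict)
  fix m assume "m \<in> {1..k}"
  then have "m + a \<in> I" using assms by auto
  then show "(\<lambda>x. x (m + a)) \<in> measurable (prodM \<mu> I) \<mu>"
    by (rule measurable_component_singleton)
qed

lemma cons_coord_measurable [measurable]:
  "(\<lambda>(x, s). cons_coord (Suc k) s x) \<in> measurable (prodM \<mu> {1..k} \<Otimes>\<^sub>M \<mu>) (prodM \<mu> {1..Suc k})"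
  unfolding cons_coord_def case_prod_beta
proof (rule measurable_restrict)
  fix m assume m: "m \<in> {1..Suc k}"
  show "(\<lambda>z. if m = 1 then snd z else fst z (m - 1)) \<in> measurable (prodM \<mu> {1..k} \<Otimes>\<^sub>M \<mu>) \<mu>"
  proof (cases "m = 1")
    case False
    then have "m - 1 \<in> {1..k}" using m by auto
    then have "(\<lambda>z. fst z (m - 1)) \<in> measurable (prodM \<mu> {1..k} \<Otimes>\<^sub>M \<mu>) \<mu>"
      by measurable
    with False show ?thesis by simp
  qed simp
qed

locale power_measure = sigma_finite_measure \<mu> for \<mu> :: "'a measure"
begin

sublocale prod: product_sigma_finite "\<lambda>_::nat. \<mu>"
  by unfold_locales

lemma sigma_finite_prodM: "finite I \<Longrightarrow> sigma_finite_measure (prodM \<mu> I)"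
  by (rule prod.sigma_finite)

text \<open>All factors are the same measure, so renaming coordinates by a bijection preserves the product;
  it suffices to compare the two measures on boxes.\<close>

lemma distr_prodM_reindex:
  assumes h: "bij_betw h I J" and I [simp]: "finite I"
  shows "distr (prodM \<mu> J) (prodM \<mu> I) (\<lambda>x. \<lambda>i\<in>I. x (h i)) = prodM \<mu> I"
proof (rule prod.PiM_eqI)
  have J [simp]: "finite J" using h I bij_betw_finite by blast
  let ?r = "\<lambda>x. \<lambda>i\<in>I. x (h i)"
  fix A assume A: "\<And>i. i \<in> I \<Longrightarrow> A i \<in> sets \<mu>"
  let ?g = "inv_into I h"
  have g: "?g j \<in> I" "h (?g j) = j" if "j \<in> J" for j
    using h that by (auto simp: bij_betw_def f_inv_into_f inv_into_into)
  have hg: "?g (h i) = i" "h i \<in> J" if "i \<in> I" for i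
    using h that by (auto simp: bij_betw_def)
  have eq: "?r -` Pi\<^sub>E I A \<inter> space (prodM \<mu> J) = Pi\<^sub>E J (\<lambda>j. A (?g j))"
  proof (intro set_eqI iffI)
    fix x assume "x \<in> ?r -` Pi\<^sub>E I A \<inter> space (prodM \<mu> J)"
    then have x: "\<And>i. i \<in> I \<Longrightarrow> x (h i) \<in> A i" "x \<in> extensional J"
      by (auto simp: PiE_iff space_PiM)
    show "x \<in> Pi\<^sub>E J (\<lambda>j. A (?g j))"
      using x(1)[OF g(1)] g(2) x(2) by (auto simp: PiE_iff)
  next
    fix x assume x: "x \<in> Pi\<^sub>E J (\<lambda>j. A (?g j))"
    have "x j \<in> space \<mu>" if "j \<in> J" for j
      using x that A[OF g(1)[OF that]] sets.sets_into_space by (fastforce simp: PiE_iff)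
    moreover have "x (h i) \<in> A i" if "i \<in> I" for i
      using x hg[OF that] by (metis PiE_mem)
    ultimately show "x \<in> ?r -` Pi\<^sub>E I A \<inter> space (prodM \<mu> J)"
      using x by (auto simp: PiE_iff space_PiM)
  qed
  have meas: "?r \<in> measurable (prodM \<mu> J) (prodM \<mu> I)"
    using hg(2) by (intro measurable_restrict measurable_component_singleton)
  have "emeasure (distr (prodM \<mu> J) (prodM \<mu> I) ?r) (Pi\<^sub>E I A) = emeasure (prodM \<mu> J) (Pi\<^sub>E J (\<lambda>j. A (?g j)))"
    using A meas by (subst emeasure_distr) (auto simp: eq)
  also have "\<dots> = (\<Prod>j\<in>J. emeasure \<mu> (A (?g j)))"
    using A g(1) by (intro prod.emeasure_PiM) auto
  also have "\<dots> = (\<Prod>i\<in>I. emeasure \<mu> (A (?g (h i))))"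
    by (rule prod.reindex_bij_betw[OF h, symmetric])
  also have "\<dots> = (\<Prod>i\<in>I. emeasure \<mu> (A i))"
    using hg by simp
  finally show "emeasure (distr (prodM \<mu> J) (prodM \<mu> I) ?r) (Pi\<^sub>E I A) = (\<Prod>i\<in>I. emeasure \<mu> (A i))" .
qed simp_all

text \<open>This makes \<open>marg1\<close>, an integral over the prepended coordinate, accessible to Fubini's theorem.\<close>

lemma distr_cons_coord:
  "distr (prodM \<mu> {1..k} \<Otimes>\<^sub>M \<mu>) (prodM \<mu> {1..Suc k}) (\<lambda>(x, s). cons_coord (Suc k) s x) = prodM \<mu> {1..Suc k}"
proof (rule prod.PiM_eqI)
  let ?c = "\<lambda>(x, s). cons_coord (Suc k) s x"
  fix A assume A: "\<And>i. i \<in> {1..Suc k} \<Longrightarrow> A i \<in> sets \<mu>"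
  have A1: "A 1 \<in> sets \<mu>" and AS: "\<And>i. i \<in> {1..k} \<Longrightarrow> A (Suc i) \<in> sets \<mu>" using A by auto
  have eq: "?c -` Pi\<^sub>E {1..Suc k} A \<inter> space (prodM \<mu> {1..k} \<Otimes>\<^sub>M \<mu>)
      = Pi\<^sub>E {1..k} (\<lambda>i. A (Suc i)) \<times> A 1"
  proof (intro set_eqI iffI)
    fix z assume z: "z \<in> ?c -` Pi\<^sub>E {1..Suc k} A \<inter> space (prodM \<mu> {1..k} \<Otimes>\<^sub>M \<mu>)"
    obtain x s where zx: "z = (x, s)" by (cases z)
    have c: "cons_coord (Suc k) s x i \<in> A i" if "i \<in> {1..Suc k}" for i
      using z that by (auto simp: zx PiE_iff)
    have "s \<in> A 1" using c[of 1] by (simp add: cons_coord_def)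
    moreover have "x i \<in> A (Suc i)" if "i \<in> {1..k}" for i
      using c[of "Suc i"] that by (simp add: cons_coord_def)
    ultimately show "z \<in> Pi\<^sub>E {1..k} (\<lambda>i. A (Suc i)) \<times> A 1"
      using z by (auto simp: zx space_pair_measure space_PiM PiE_iff)
  next
    fix z assume z: "z \<in> Pi\<^sub>E {1..k} (\<lambda>i. A (Suc i)) \<times> A 1"
    obtain x s where zx: "z = (x, s)" by (cases z)
    have x: "\<And>i. i \<in> {1..k} \<Longrightarrow> x i \<in> A (Suc i)" and s: "s \<in> A 1"
      using z by (auto simp: zx PiE_iff)
    have c: "cons_coord (Suc k) s x i \<in> A i" if i: "i \<in> {1..Suc k}" for i
    proof (cases "i = 1")
      case False
      then have "i - 1 \<in> {1..k}" "Suc (i - 1) = i" using i by auto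
      then show ?thesis using x[of "i - 1"] False i by (simp add: cons_coord_def)
    qed (use s in \<open>simp add: cons_coord_def\<close>)
    have "x i \<in> space \<mu>" if "i \<in> {1..k}" for i
      using x[OF that] AS[OF that] sets.sets_into_space by blast
    moreover have "s \<in> space \<mu>" using s A1 sets.sets_into_space by blast
    ultimately show "z \<in> ?c -` Pi\<^sub>E {1..Suc k} A \<inter> space (prodM \<mu> {1..k} \<Otimes>\<^sub>M \<mu>)"
      using c z by (auto simp: zx space_pair_measure space_PiM PiE_iff cons_coord_def)
  qed
  have "emeasure (distr (prodM \<mu> {1..k} \<Otimes>\<^sub>M \<mu>) (prodM \<mu> {1..Suc k}) ?c) (Pi\<^sub>E {1..Suc k} A)
      = emeasure (prodM \<mu> {1..k} \<Otimes>\<^sub>M \<mu>) (Pi\<^sub>E {1..k} (\<lambda>i. A (Suc i)) \<times> A 1)"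
    unfolding eq[symmetric]
    by (rule emeasure_distr[OF cons_coord_measurable]) (use A in \<open>auto intro!: sets_PiM_I_finite\<close>)
  also have "\<dots> = emeasure (prodM \<mu> {1..k}) (Pi\<^sub>E {1..k} (\<lambda>i. A (Suc i))) * emeasure \<mu> (A 1)"
    using AS A1 by (intro emeasure_pair_measure_Times) (auto intro!: sets_PiM_I_finite)
  also have "\<dots> = (\<Prod>i\<in>{1..k}. emeasure \<mu> (A (Suc i))) * emeasure \<mu> (A 1)"
    using AS by (subst prod.emeasure_PiM) auto
  also have "\<dots> = (\<Prod>i\<in>{1..Suc k}. emeasure \<mu> (A i))"
  proof -
    have "(\<Prod>i\<in>{1..Suc k}. emeasure \<mu> (A i)) = emeasure \<mu> (A 1) * (\<Prod>i\<in>{Suc 1..Suc k}. emeasure \<mu> (A i))"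
      by (rule prod.atLeast_Suc_atMost) simp
    also have "(\<Prod>i\<in>{Suc 1..Suc k}. emeasure \<mu> (A i)) = (\<Prod>i\<in>{1..k}. emeasure \<mu> (A (Suc i)))"
      by (rule prod.shift_bounds_cl_Suc_ivl)
    finally show ?thesis by (simp only: mult.commute)
  qed
  finally show "emeasure (distr (prodM \<mu> {1..k} \<Otimes>\<^sub>M \<mu>) (prodM \<mu> {1..Suc k}) ?c) (Pi\<^sub>E {1..Suc k} A)
      = (\<Prod>i\<in>{1..Suc k}. emeasure \<mu> (A i))" .
qed simp_all

lemma
  assumes H: "integrable (prodM \<mu> {1..Suc k}) H"
  shows integrable_marg1: "integrable (prodM \<mu> {1..k}) (marg1 \<mu> (Suc k) H)"
    and integral_marg1: "(\<integral>x. marg1 \<mu> (Suc k) H x \<partial>prodM \<mu> {1..k}) = (\<integral>x. H x \<partial>prodM \<mu> {1..Suc k})"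
proof -
  interpret k: sigma_finite_measure "prodM \<mu> {1..k}" by (rule sigma_finite_prodM) simp
  interpret pair: pair_sigma_finite "prodM \<mu> {1..k}" \<mu> by unfold_locales
  let ?c = "\<lambda>(x, s). cons_coord (Suc k) s x"
  have int: "integrable (prodM \<mu> {1..k} \<Otimes>\<^sub>M \<mu>) (\<lambda>z. H (?c z))"
    by (rule integrable_distr[OF cons_coord_measurable]) (subst distr_cons_coord, rule H)
  then have int': "integrable (prodM \<mu> {1..k} \<Otimes>\<^sub>M \<mu>) (\<lambda>(x, s). H (cons_coord (Suc k) s x))"
    by (simp add: case_prod_beta')
  show "integrable (prodM \<mu> {1..k}) (marg1 \<mu> (Suc k) H)"
    using pair.integrable_fst[OF int'] by (simp add: marg1_def[abs_def])
  have "(\<integral>x. H x \<partial>prodM \<mu> {1..Suc k}) = (\<integral>z. H (?c z) \<partial>(prodM \<mu> {1..k} \<Otimes>\<^sub>M \<mu>))"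
    using integral_distr[OF cons_coord_measurable borel_measurable_integrable[OF H]]
    by (simp add: distr_cons_coord)
  also have "\<dots> = (\<integral>x. marg1 \<mu> (Suc k) H x \<partial>prodM \<mu> {1..k})"
    using pair.integral_fst[OF int'] by (simp add: marg1_def[abs_def] case_prod_beta')
  finally show "(\<integral>x. marg1 \<mu> (Suc k) H x \<partial>prodM \<mu> {1..k}) = (\<integral>x. H x \<partial>prodM \<mu> {1..Suc k})" ..
qed

section \<open>The functional \<open>\<Psi>\<close> and masses of tail events\<close>

text \<open>Every summand of \<open>\<Psi>\<^sub>k(H)\<close> is the integral of a positive part, that is, the \<open>H\<close>-mass of the event
  where a marginal of \<open>H\<close> is nonnegative.  Such an event depends only on the coordinates after the
  \<open>l\<close>-th one, so a uniform bound \<open>b l\<close> on the masses of these events bounds the summand.\<close>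

lemma Psi_le_sum:
  assumes H: "integrable (prodM \<mu> {1..k}) H"
    and b: "\<And>l A. l < k \<Longrightarrow> A \<in> sets (prodM \<mu> {1..k - l}) \<Longrightarrow>
      (\<integral>x. H x * indicator A (window l (k - l) x) \<partial>prodM \<mu> {1..k}) \<le> b l"
  shows "Psi \<mu> k H \<le> (\<Sum>l<k. b l)"
  using assms
proof (induction k arbitrary: H b)
  case (Suc k)
  note H = Suc.prems(1) and b = Suc.prems(2)
  have [measurable]: "H \<in> borel_measurable (prodM \<mu> {1..Suc k})" using H by auto
  let ?A = "{x \<in> space (prodM \<mu> {1..Suc k}). 0 \<le> H x}"
  have "(\<integral>x. max (H x) 0 \<partial>prodM \<mu> {1..Suc k})
      = (\<integral>x. H x * indicator ?A (window 0 (Suc k - 0) x) \<partial>prodM \<mu> {1..Suc k})"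
  proof (rule Bochner_Integration.integral_cong[OF refl])
    fix x assume x: "x \<in> space (prodM \<mu> {1..Suc k})"
    then have "window 0 (Suc k - 0) x = x"
      by (auto simp: window_def space_PiM fun_eq_iff PiE_def extensional_def)
    then show "max (H x) 0 = H x * indicator ?A (window 0 (Suc k - 0) x)"
      using x by (auto simp: indicator_def)
  qed
  also have "\<dots> \<le> b 0" by (rule b) (auto simp del: One_nat_def)
  finally have first: "(\<integral>x. max (H x) 0 \<partial>prodM \<mu> {1..Suc k}) \<le> b 0" .
  have "Psi \<mu> k (marg1 \<mu> (Suc k) H) \<le> (\<Sum>l<k. b (Suc l))"
  proof (rule Suc.IH[OF integrable_marg1[OF H]])
    fix l A assume l: "l < k" and A [measurable]: "A \<in> sets (prodM \<mu> {1..k - l})"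
    have [measurable]: "window (Suc l) (k - l) \<in> measurable (prodM \<mu> {1..Suc k}) (prodM \<mu> {1..k - l})"
      using l by (intro window_measurable) auto
    let ?H = "\<lambda>x. H x * indicator A (window (Suc l) (Suc k - Suc l) x)"
    have int: "integrable (prodM \<mu> {1..Suc k}) ?H"
      by (rule Bochner_Integration.integrable_bound[OF H]) (auto simp: indicator_def)
    have "window (Suc l) (k - l) (cons_coord (Suc k) s x) = window l (k - l) x" for s and x :: "nat \<Rightarrow> 'a"
      using l by (auto simp: window_def cons_coord_def fun_eq_iff)
    then have "(\<integral>x. marg1 \<mu> (Suc k) H x * indicator A (window l (k - l) x) \<partial>prodM \<mu> {1..k})
        = (\<integral>x. marg1 \<mu> (Suc k) ?H x \<partial>prodM \<mu> {1..k})"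
      by (simp add: marg1_def)
    also have "\<dots> = (\<integral>x. ?H x \<partial>prodM \<mu> {1..Suc k})"
      by (rule integral_marg1[OF int])
    also have "\<dots> \<le> b (Suc l)"
      by (rule b) (use l in auto)
    finally show "(\<integral>x. marg1 \<mu> (Suc k) H x * indicator A (window l (k - l) x) \<partial>prodM \<mu> {1..k}) \<le> b (Suc l)" .
  qed
  with first show ?case
    by (simp add: sum.lessThan_Suc_shift del: sum.lessThan_Suc)
qed simp

end

section \<open>Metrics that ignore common coordinates\<close>

text \<open>What the oscillation bound uses of the metrics.  The assumption \<open>diam_base\<close> is a consequence of
  \<open>\<Psi>\<close>-dominance (\<open>diam_le_1\<close> below).\<close>

locale deletion_metrics =
  fixes n :: nat and S :: "'a set" and \<rho> :: "nat \<Rightarrow> (nat \<Rightarrow> 'a) \<Rightarrow> (nat \<Rightarrow> 'a) \<Rightarrow> real"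
  assumes metric: "k \<in> {1..n} \<Longrightarrow> Metric_space (Spow S k) (\<rho> k)"
    and deletion: "\<lbrakk>k \<in> {2..n}; i \<in> {1..k}; x \<in> Spow S k; y \<in> Spow S k; x i = y i\<rbrakk> \<Longrightarrow>
      \<rho> k x y = \<rho> (k - 1) (del_coord k i x) (del_coord k i y)"
    and diam_base: "\<lbrakk>1 \<le> n; x \<in> Spow S 1; y \<in> Spow S 1\<rbrakk> \<Longrightarrow> \<rho> 1 x y \<le> 1"
begin

lemma del_coord_in_Spow:
  assumes "x \<in> Spow S k" "i \<in> {1..k}"
  shows "del_coord k i x \<in> Spow S (k - 1)"
proof -
  have "x m \<in> S" if "m \<in> {1..k}" for m using assms(1) that by (auto simp: PiE_iff)
  then show ?thesis by (auto simp: del_coord_def PiE_iff)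
qed

lemma dist_common_prefix:
  assumes k: "k \<in> {1..n}" and "a < k" and x: "x \<in> Spow S k" and y: "y \<in> Spow S k"
    and "\<And>m. m \<in> {1..a} \<Longrightarrow> x m = y m"
  shows "\<rho> k x y = \<rho> (k - a) (window a (k - a) x) (window a (k - a) y)"
  using assms(2,5)
proof (induction a)
  case 0
  have "window 0 k z = z" if "z \<in> Spow S k" for z
    using that by (auto simp: window_def fun_eq_iff PiE_def extensional_def)
  then show ?case using x y by simp
next
  case (Suc a)
  have win: "window a (k - a) z \<in> Spow S (k - a)" if "z \<in> Spow S k" for z
    using that Suc.prems by (auto simp: window_def PiE_iff)
  have del: "del_coord (k - a) 1 (window a (k - a) z) = window (Suc a) (k - Suc a) z" for z :: "nat \<Rightarrow> 'a"
    using Suc.prems by (auto simp: window_def del_coord_def fun_eq_iff)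
  have "\<rho> k x y = \<rho> (k - a) (window a (k - a) x) (window a (k - a) y)"
    using Suc by simp
  also have "\<dots> = \<rho> (k - a - 1) (del_coord (k - a) 1 (window a (k - a) x))
      (del_coord (k - a) 1 (window a (k - a) y))"
    using Suc.prems(1) Suc.prems(2)[of "1 + a"] k
    by (intro deletion win x y) (auto simp: window_def)
  also have "\<dots> = \<rho> (k - Suc a) (window (Suc a) (k - Suc a) x) (window (Suc a) (k - Suc a) y)"
    by (simp add: del flip: Suc_eq_plus1)
  finally show ?case .
qed

text \<open>Delete one common coordinate after the other until only the coordinate \<open>i\<close> is left.\<close>

lemma dist_one_coordinate:
  assumes "k \<in> {1..n}" "x \<in> Spow S k" "y \<in> Spow S k"
    and "\<And>m. m \<in> {1..k} - {i} \<Longrightarrow> x m = y m"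
  shows "\<rho> k x y \<le> 1"
  using assms
proof (induction k arbitrary: x y i)
  case (Suc k)
  show ?case
  proof (cases "k = 0")
    case True
    then show ?thesis using Suc.prems(1-3) diam_base[of x y] by (simp add: One_nat_def)
  next
    case False
    note xy = Suc.prems(2,3)
    \<comment> \<open>a coordinate other than \<open>i\<close>, on which both points agree\<close>
    define c where "c = (if i = 1 then Suc k else 1)"
    have c: "c \<in> {1..Suc k}" "c \<noteq> i" using False by (auto simp: c_def)
    have "\<rho> (Suc k) x y = \<rho> (Suc k - 1) (del_coord (Suc k) c x) (del_coord (Suc k) c y)"
      using Suc.prems(1) False c by (intro deletion xy Suc.prems(4)) auto
    also have "\<dots> \<le> 1"
      unfolding diff_Suc_1
    proof (rule Suc.IH)
      show "k \<in> {1..n}" using Suc.prems(1) False by auto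
      show "del_coord (Suc k) c x \<in> Spow S k" "del_coord (Suc k) c y \<in> Spow S k"
        using del_coord_in_Spow[OF xy(1) c(1)] del_coord_in_Spow[OF xy(2) c(1)] by simp_all
      fix m assume m: "m \<in> {1..k} - {if i = 1 then 1 else i - 1}"
      then show "del_coord (Suc k) c x m = del_coord (Suc k) c y m"
        using Suc.prems(4) by (auto simp: del_coord_def c_def split: if_splits)
    qed
    finally show ?thesis .
  qed
qed simp

text \<open>Change the coordinates of \<open>x\<close> into those of \<open>y\<close> one at a time.  This makes Lipschitz functions bounded.\<close>

lemma dist_le:
  assumes "k \<in> {1..n}" and x: "x \<in> Spow S k" and y: "y \<in> Spow S k"
  shows "\<rho> k x y \<le> k"
proof -
  interpret Metric_space "Spow S k" "\<rho> k" using assms(1) by (rule metric)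
  \<comment> \<open>the hybrid of the two points after \<open>l\<close> changes\<close>
  define h where "h l = (\<lambda>m. if m \<le> l then y m else x m)" for l
  have h: "h l \<in> Spow S k" for l
    using x y by (auto simp: h_def PiE_iff extensional_def)
  have "\<rho> k x (h l) \<le> l" for l
  proof (induction l)
    case 0
    have "h 0 = x" using x y by (auto simp: h_def fun_eq_iff PiE_iff extensional_def)
    then show ?case using x by simp
  next
    case (Suc l)
    have "\<rho> k (h l) (h (Suc l)) \<le> 1"
      by (rule dist_one_coordinate[where i = "Suc l", OF assms(1) h h]) (auto simp: h_def)
    then show ?case using triangle[OF x h[of l] h[of "Suc l"]] Suc by simp
  qed
  from this[of k] show ?thesis
  proof -
    assume "\<rho> k x (h k) \<le> real k"
    moreover have "h k = y"
    proof
      fix m show "h k m = y m"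
        using x y by (cases "m \<in> {1..k}") (auto simp: h_def PiE_iff extensional_def)
    qed
    ultimately show ?thesis by simp
  qed
qed

end

section \<open>Lipschitz functions\<close>

text \<open>The infimum in \<open>lip_norm\<close> is attained.\<close>

lemma lip_norm_bound:
  assumes "Metric_space X d" "is_lipschitz X d f" "x \<in> X" "y \<in> X"
  shows "\<bar>f x - f y\<bar> \<le> lip_norm X d f * d x y"
proof -
  interpret Metric_space X d by fact
  have ne: "lip_bounds X d f \<noteq> {}" using assms(2) by (simp add: is_lipschitz_def)
  show ?thesis
  proof (cases "d x y = 0")
    case True
    then show ?thesis using assms(3,4) by simp
  next
    case False
    then have pos: "0 < d x y" using nonneg[of x y] by linarith
    have "\<bar>f x - f y\<bar> / d x y \<le> lip_norm X d f"
      unfolding lip_norm_def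
    proof (rule cInf_greatest[OF ne])
      fix C assume "C \<in> lip_bounds X d f"
      then have "\<bar>f x - f y\<bar> \<le> C * d x y" using assms(3,4) by (auto simp: lip_bounds_def)
      then show "\<bar>f x - f y\<bar> / d x y \<le> C" using pos by (simp add: divide_le_eq)
    qed
    then show ?thesis using pos by (simp add: divide_le_eq)
  qed
qed

lemma lip_norm_nonneg: "is_lipschitz X d f \<Longrightarrow> 0 \<le> lip_norm X d f"
  unfolding lip_norm_def is_lipschitz_def by (rule cInf_greatest) (auto simp: lip_bounds_def)

lemma lipschitz_borel_measurable:
  fixes f :: "'b \<Rightarrow> real"
  assumes "Metric_space X d" and L: "\<And>x y. x \<in> X \<Longrightarrow> y \<in> X \<Longrightarrow> \<bar>f x - f y\<bar> \<le> L * d x y"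
  shows "f \<in> borel_measurable (metric_borel X d)"
proof -
  interpret Metric_space X d by fact
  have sub: "{U. openin mtopology U} \<subseteq> Pow X"
    using openin_subset by fastforce
  have space: "space (metric_borel X d) = X"
    unfolding metric_borel_def using sub by (rule space_measure_of)
  show ?thesis
  proof (rule borel_measurableI)
    fix V :: "real set" assume V: "open V"
    have "openin mtopology (f -` V \<inter> X)"
      unfolding openin_mtopology
    proof (intro conjI strip)
      fix x assume x: "x \<in> f -` V \<inter> X"
      then obtain e where e: "0 < e" "ball (f x) e \<subseteq> V"
        using V openE by blast
      let ?r = "e / (\<bar>L\<bar> + 1)"
      have "mball x ?r \<subseteq> f -` V \<inter> X"
      proof
        fix y assume y: "y \<in> mball x ?r"
        have "\<bar>f x - f y\<bar> \<le> L * d x y" using L y by auto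
        also have "\<dots> \<le> (\<bar>L\<bar> + 1) * d x y"
          by (rule mult_right_mono) auto
        also have "\<dots> < e"
          using y by (auto simp: field_simps)
        finally have "f y \<in> V" using e(2) by (auto simp: dist_real_def)
        then show "y \<in> f -` V \<inter> X" using y by auto
      qed
      moreover have "0 < ?r" using e(1) by simp
      ultimately show "\<exists>r>0. mball x r \<subseteq> f -` V \<inter> X" by blast
    qed simp
    then show "f -` V \<inter> space (metric_borel X d) \<in> sets (metric_borel X d)"
      unfolding space unfolding metric_borel_def sets_measure_of[OF sub]
      by (intro sigma_sets.Basic) simp
  qed
qed

section \<open>Exponential moments of a variable of small oscillation\<close>

text \<open>Hoeffding's lemma on the interval of length \<open>2 c\<close> around the mean, for \<open>l\<close> of either sign.\<close>

lemma (in prob_space) Hoeffding_lemma_centred: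
  fixes X :: "'a \<Rightarrow> real"
  assumes X [measurable]: "random_variable borel X"
    and c: "AE w in M. \<bar>X w - expectation X\<bar> \<le> c"
  shows "(\<integral>\<^sup>+w. exp (l * (X w - expectation X)) \<partial>M) \<le> ennreal (exp (l\<^sup>2 * c\<^sup>2 / 2))"
proof -
  have pos: "(\<integral>\<^sup>+w. exp (h * (Y w - expectation Y)) \<partial>M) \<le> ennreal (exp (h\<^sup>2 * c\<^sup>2 / 2))"
    if h: "0 < h" and Y [measurable]: "random_variable borel Y"
      and Yc: "AE w in M. \<bar>Y w - expectation Y\<bar> \<le> c" for h and Y :: "'a \<Rightarrow> real"
  proof -
    interpret interval_bounded_random_variable M Y "expectation Y - c" "expectation Y + c"
      by unfold_locales (use Yc in \<open>auto elim!: eventually_mono\<close>)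
    show ?thesis using Hoeffdings_lemma_nn_integral[OF h] by (simp add: power_mult_distrib mult.commute)
  qed
  consider "0 < l" | "l = 0" | "l < 0" by linarith
  then show ?thesis
  proof cases
    case 3
    have "AE w in M. \<bar>- X w - expectation (\<lambda>w. - X w)\<bar> \<le> c"
      using c by (auto elim!: eventually_mono)
    from pos[OF _ _ this, of "- l"] 3 show ?thesis by (simp add: algebra_simps)
  qed (use pos[OF _ X c] in \<open>simp_all add: emeasure_space_1\<close>)
qed

lemma ennreal_exp_mult:
  "ennreal (exp a) * ennreal (exp b) = ennreal (exp (a + b))"
  "ennreal (exp a) * (ennreal (exp b) * c) = ennreal (exp (a + b)) * c"
  by (simp_all add: ennreal_mult exp_add mult.assoc)

text \<open>Markov's inequality for \<open>exp(\<plusminus>l X)\<close> with the optimal choice \<open>l = t / v\<close>.\<close>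

lemma (in prob_space) subgaussian_tail:
  fixes X :: "'a \<Rightarrow> real"
  assumes X [measurable]: "random_variable borel X" and v: "0 < v" and t: "0 < t"
    and mgf: "\<And>l. (\<integral>\<^sup>+w. exp (l * X w) \<partial>M) \<le> ennreal (exp (l\<^sup>2 * v / 2))"
  shows "prob {w \<in> space M. \<bar>X w\<bar> > t} \<le> 2 * exp (- (t\<^sup>2 / (2 * v)))"
proof -
  define K where "K = exp (- (t\<^sup>2 / (2 * v)))"
  have tail: "emeasure M {w \<in> space M. t < s * X w} \<le> ennreal K"
    if s: "s\<^sup>2 = 1" for s
  proof -
    define l where "l = t / v"
    have l: "0 < l" using v t by (simp add: l_def)
    have "emeasure M {w \<in> space M. t < s * X w}
        = (\<integral>\<^sup>+w. indicator {w \<in> space M. t < s * X w} w \<partial>M)"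
      by (rule nn_integral_indicator[symmetric]) measurable
    also have "\<dots> \<le> (\<integral>\<^sup>+w. ennreal (exp (- (l * t))) * ennreal (exp ((l * s) * X w)) \<partial>M)"
    proof (rule nn_integral_mono)
      fix w
      have "1 \<le> exp (- (l * t)) * exp ((l * s) * X w)" if "t < s * X w"
      proof -
        have "l * t \<le> l * (s * X w)" using that l by simp
        then show ?thesis by (simp add: mult_exp_exp mult.assoc)
      qed
      then show "indicator {w \<in> space M. t < s * X w} w
          \<le> ennreal (exp (- (l * t))) * ennreal (exp ((l * s) * X w))"
        by (auto simp: indicator_def ennreal_mult[symmetric] simp flip: ennreal_1)
    qed
    also have "\<dots> = ennreal (exp (- (l * t))) * (\<integral>\<^sup>+w. ennreal (exp ((l * s) * X w)) \<partial>M)"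
      by (rule nn_integral_cmult) measurable
    also have "\<dots> \<le> ennreal (exp (- (l * t))) * ennreal (exp ((l * s)\<^sup>2 * v / 2))"
      by (intro mult_left_mono mgf) simp
    also have "\<dots> = ennreal (exp (- (l * t) + l\<^sup>2 * v / 2))"
      by (simp add: power_mult_distrib s ennreal_exp_mult)
    also have "- (l * t) + l\<^sup>2 * v / 2 = - (t\<^sup>2 / (2 * v))"
      using v by (simp add: l_def field_simps power2_eq_square)
    finally show ?thesis by (simp add: K_def)
  qed
  have "emeasure M {w \<in> space M. \<bar>X w\<bar> > t}
      \<le> emeasure M ({w \<in> space M. t < 1 * X w} \<union> {w \<in> space M. t < (-1) * X w})"
    by (rule emeasure_mono) auto
  also have "\<dots> \<le> emeasure M {w \<in> space M. t < 1 * X w} + emeasure M {w \<in> space M. t < (-1) * X w}"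
    by (rule emeasure_subadditive) measurable
  also have "\<dots> \<le> ennreal K + ennreal K"
    by (intro add_mono tail) simp_all
  also have "\<dots> = ennreal (2 * K)"
    by (simp add: K_def ennreal_plus[symmetric] del: ennreal_plus)
  finally show ?thesis
    unfolding K_def[symmetric] by (simp add: emeasure_eq_measure K_def)
qed

section \<open>Conditional densities and conditional means\<close>

context power_measure
begin

lemma merge_prefix_measurable [measurable]:
  assumes "i \<le> n"
  shows "merge {1..i} {i + 1..n} \<in>
    measurable (prodM \<mu> {1..i} \<Otimes>\<^sub>M prodM \<mu> {i + 1..n}) (prodM \<mu> {1..n})"
proof -
  have "{1..i} \<union> {i + 1..n} = {1..n}" using assms by auto
  then show ?thesis using measurable_merge[of "{1..i}" "{i + 1..n}" "\<lambda>_. \<mu>"] by simp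
qed

lemma marg_density_measurable:
  assumes [measurable]: "p \<in> borel_measurable (prodM \<mu> {1..n})" and i: "i \<le> n"
  shows "marg_density \<mu> p n i \<in> borel_measurable (prodM \<mu> {1..i})"
proof -
  interpret J: sigma_finite_measure "prodM \<mu> {i + 1..n}" by (rule sigma_finite_prodM) simp
  have "(\<lambda>(z, x). p (merge {1..i} {i + 1..n} (z, x))) \<in>
      borel_measurable (prodM \<mu> {1..i} \<Otimes>\<^sub>M prodM \<mu> {i + 1..n})"
    using merge_prefix_measurable[OF i] by simp
  then show ?thesis
    unfolding marg_density_def[abs_def] by (rule J.borel_measurable_nn_integral)
qed

lemma nn_integral_last_coord:
  assumes "g \<in> borel_measurable (prodM \<mu> {1..i})" and i: "1 \<le> i"
  shows "(\<integral>\<^sup>+z. g z \<partial>prodM \<mu> {1..i}) = (\<integral>\<^sup>+y. \<integral>\<^sup>+w. g (y(i := w)) \<partial>\<mu> \<partial>prodM \<mu> {1..i - 1})"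
proof -
  have "{1..i} = insert i {1..i - 1}" using i by auto
  then show ?thesis
    using prod.product_nn_integral_insert[of "{1..i - 1}" i g] assms by simp
qed

lemma update_last_measurable [measurable]:
  assumes "1 \<le> i"
  shows "(\<lambda>(y, w). y(i := w)) \<in> measurable (prodM \<mu> {1..i - 1} \<Otimes>\<^sub>M \<mu>) (prodM \<mu> {1..i})"
proof -
  have "{1..i} = insert i {1..i - 1}" using assms by auto
  then show ?thesis using measurable_add_dim[of i "{1..i - 1}" "\<lambda>_. \<mu>"] by simp
qed

text \<open>Integrating out the coordinate \<open>i\<close> after the later ones.  The identity is stated for every measurable
  \<open>p\<close>, because it is needed both for the density and for its product with \<open>f\<close>; it holds at every point
  \<open>y\<close>, not only almost everywhere, since only nonnegative integrals are involved.\<close>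

lemma marg_density_step:
  assumes p: "p \<in> borel_measurable (prodM \<mu> {1..n})" and i: "i \<in> {1..n}"
    and y: "y \<in> Spow (space \<mu>) (i - 1)"
  shows "marg_density \<mu> p n (i - 1) y = (\<integral>\<^sup>+w. marg_density \<mu> p n i (y(i := w)) \<partial>\<mu>)"
proof -
  have J: "{i - 1 + 1..n} = insert i {i + 1..n}" using i by auto
  have "(\<lambda>x. (y, x)) \<in> measurable (prodM \<mu> {i - 1 + 1..n}) (prodM \<mu> {1..i - 1} \<Otimes>\<^sub>M prodM \<mu> {i - 1 + 1..n})"
    using y by (intro measurable_Pair1') (simp add: space_PiM)
  moreover have "i - 1 \<le> n" using i by auto
  ultimately have "(\<lambda>x. p (merge {1..i - 1} {i - 1 + 1..n} (y, x))) \<in> borel_measurable (prodM \<mu> {i - 1 + 1..n})"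
    using p merge_prefix_measurable by measurable
  then have "marg_density \<mu> p n (i - 1) y
      = (\<integral>\<^sup>+w. \<integral>\<^sup>+x. p (merge {1..i - 1} {i - 1 + 1..n} (y, x(i := w))) \<partial>prodM \<mu> {i + 1..n} \<partial>\<mu>)"
    unfolding marg_density_def J by (intro prod.product_nn_integral_insert_rev) auto
  also have "\<dots> = (\<integral>\<^sup>+w. marg_density \<mu> p n i (y(i := w)) \<partial>\<mu>)"
  proof -
    have "merge {1..i - 1} {i - 1 + 1..n} (y, x(i := w)) = merge {1..i} {i + 1..n} (y(i := w), x)"
      for x :: "nat \<Rightarrow> 'a" and w
      using i by (auto simp: merge_def fun_eq_iff)
    then show ?thesis by (simp add: marg_density_def)
  qed
  finally show ?thesis .
qed

lemma nn_integral_marg_density: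
  assumes p: "p \<in> borel_measurable (prodM \<mu> {1..n})" and i: "i \<le> n"
  shows "(\<integral>\<^sup>+z. marg_density \<mu> p n i z \<partial>prodM \<mu> {1..i}) = (\<integral>\<^sup>+x. p x \<partial>prodM \<mu> {1..n})"
proof -
  have "{1..i} \<union> {i + 1..n} = {1..n}" using i by auto
  then show ?thesis
    using prod.product_nn_integral_fold[of "{1..i}" "{i + 1..n}" p] p
    by (simp add: marg_density_def)
qed

end

locale coordinate_density = power_measure \<mu> for \<mu> :: "'a measure" +
  fixes n :: nat and p :: "(nat \<Rightarrow> 'a) \<Rightarrow> ennreal"
  assumes p_measurable [measurable]: "p \<in> borel_measurable (prodM \<mu> {1..n})"
    and p_prob: "(\<integral>\<^sup>+x. p x \<partial>prodM \<mu> {1..n}) = 1"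
begin

abbreviation m :: "nat \<Rightarrow> (nat \<Rightarrow> 'a) \<Rightarrow> ennreal" where
  "m \<equiv> marg_density \<mu> p n"

text \<open>The law of the first \<open>i\<close> coordinates, including the trivial one for \<open>i = 0\<close>, at which the martingale
  starts.\<close>

definition law :: "nat \<Rightarrow> (nat \<Rightarrow> 'a) measure" where
  "law i = density (prodM \<mu> {1..i}) (m i)"

lemma m_measurable [measurable]: "i \<le> n \<Longrightarrow> m i \<in> borel_measurable (prodM \<mu> {1..i})"
  by (rule marg_density_measurable[OF p_measurable])

lemma AE_m_finite: "i \<le> n \<Longrightarrow> AE z in prodM \<mu> {1..i}. m i z \<noteq> \<infinity>"
  by (rule nn_integral_PInf_AE) (simp_all add: nn_integral_marg_density p_prob)

lemma AE_law:
  assumes "i \<le> n" shows "AE z in law i. 0 < m i z \<and> m i z \<noteq> \<infinity>"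
  unfolding law_def using AE_m_finite[OF assms] assms
  by (subst AE_density) (auto elim!: eventually_mono)

lemma m_full:
  assumes "x \<in> Spow (space \<mu>) n"
  shows "m n x = p x"
proof -
  have "merge {1..n} {n + 1..n} (x, y) = x" for y
    using assms by (auto simp: merge_def fun_eq_iff PiE_def extensional_def)
  then show ?thesis by (simp add: marg_density_def PiM_empty nn_integral_count_space_finite)
qed

lemma law_full: "law n = density (prodM \<mu> {1..n}) p"
  unfolding law_def by (rule density_cong) (auto simp: space_PiM m_full intro!: AE_I2)

text \<open>The marginal laws with densities are consistent, which identifies them with the given consistent
  family.\<close>

lemma law_pred:
  assumes i: "i \<in> {1..n}"
  shows "distr (law i) (prodM \<mu> {1..i - 1}) (\<lambda>x. restrict x {1..i - 1}) = law (i - 1)"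
proof (rule measure_eqI)
  have i': "i \<le> n" "1 \<le> i" "i - 1 \<le> n" using i by auto
  have [measurable]: "(\<lambda>x. restrict x {1..i - 1}) \<in> measurable (prodM \<mu> {1..i}) (prodM \<mu> {1..i - 1})"
    by (rule measurable_restrict_subset) auto
  note [measurable] = m_measurable[OF i'(1)] m_measurable[OF i'(3)]
  fix A assume "A \<in> sets (distr (law i) (prodM \<mu> {1..i - 1}) (\<lambda>x. restrict x {1..i - 1}))"
  then have A [measurable]: "A \<in> sets (prodM \<mu> {1..i - 1})" by simp
  have "emeasure (distr (law i) (prodM \<mu> {1..i - 1}) (\<lambda>x. restrict x {1..i - 1})) A
      = (\<integral>\<^sup>+x. indicator A x \<partial>distr (law i) (prodM \<mu> {1..i - 1}) (\<lambda>x. restrict x {1..i - 1}))"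
    by simp
  also have "\<dots> = (\<integral>\<^sup>+z. indicator A (restrict z {1..i - 1}) \<partial>law i)"
    by (rule nn_integral_distr) (simp_all add: law_def)
  also have "\<dots> = (\<integral>\<^sup>+z. m i z * indicator A (restrict z {1..i - 1}) \<partial>prodM \<mu> {1..i})"
    unfolding law_def by (rule nn_integral_density) measurable
  also have "\<dots> = (\<integral>\<^sup>+y. \<integral>\<^sup>+w. m i (y(i := w)) * indicator A (restrict (y(i := w)) {1..i - 1})
      \<partial>\<mu> \<partial>prodM \<mu> {1..i - 1})"
    by (rule nn_integral_last_coord) (use i' in simp_all)
  also have "\<dots> = (\<integral>\<^sup>+y. m (i - 1) y * indicator A y \<partial>prodM \<mu> {1..i - 1})"
  proof (rule nn_integral_cong)
    fix y assume y: "y \<in> space (prodM \<mu> {1..i - 1})"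
    have res: "restrict (y(i := w)) {1..i - 1} = y" for w
      using y i'(2) by (auto simp: space_PiM fun_eq_iff PiE_def extensional_def)
    have [measurable]: "(\<lambda>w. m i (y(i := w))) \<in> borel_measurable \<mu>"
      using measurable_compose[OF measurable_Pair1'[OF y] update_last_measurable[OF i'(2)]]
      by (auto intro: measurable_compose[OF _ m_measurable[OF i'(1)]])
    show "(\<integral>\<^sup>+w. m i (y(i := w)) * indicator A (restrict (y(i := w)) {1..i - 1}) \<partial>\<mu>)
        = m (i - 1) y * indicator A y"
      using marg_density_step[OF p_measurable i, of y] y
      by (simp add: res nn_integral_multc space_PiM)
  qed
  also have "\<dots> = emeasure (law (i - 1)) A"
    unfolding law_def using A by (subst emeasure_density) auto
  finally show "emeasure (distr (law i) (prodM \<mu> {1..i - 1}) (\<lambda>x. restrict x {1..i - 1})) A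
      = emeasure (law (i - 1)) A" .
qed (simp add: law_def)

end

text \<open>Bayes' formula for the conditional mean \<open>F\<^sub>i(z)\<close> given the first \<open>i\<close> coordinates, meant for nonnegative
  \<open>f\<close>, so that all integrals exist in \<open>[0, \<infinity>]\<close>.\<close>

definition cond_mean ::
  "'a measure \<Rightarrow> ((nat \<Rightarrow> 'a) \<Rightarrow> ennreal) \<Rightarrow> nat \<Rightarrow> ((nat \<Rightarrow> 'a) \<Rightarrow> real) \<Rightarrow> nat \<Rightarrow> (nat \<Rightarrow> 'a) \<Rightarrow> real"
where
  "cond_mean \<mu> p n f i z =
     enn2real (marg_density \<mu> (\<lambda>x. ennreal (f x) * p x) n i z / marg_density \<mu> p n i z)"

locale bounded_observable = coordinate_density \<mu> n p
  for \<mu> :: "'a measure" and n :: nat and p :: "(nat \<Rightarrow> 'a) \<Rightarrow> ennreal" +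
  fixes f :: "(nat \<Rightarrow> 'a) \<Rightarrow> real" and B :: real
  assumes f_measurable [measurable]: "f \<in> borel_measurable (prodM \<mu> {1..n})"
    and f_bounds: "x \<in> Spow (space \<mu>) n \<Longrightarrow> 0 \<le> f x \<and> f x \<le> B"
begin

abbreviation u :: "nat \<Rightarrow> (nat \<Rightarrow> 'a) \<Rightarrow> ennreal" where
  "u \<equiv> marg_density \<mu> (\<lambda>x. ennreal (f x) * p x) n"

abbreviation F :: "nat \<Rightarrow> (nat \<Rightarrow> 'a) \<Rightarrow> real" where
  "F \<equiv> cond_mean \<mu> p n f"

lemma fp_measurable [measurable]: "(\<lambda>x. ennreal (f x) * p x) \<in> borel_measurable (prodM \<mu> {1..n})"
  by measurable

lemma u_measurable [measurable]: "i \<le> n \<Longrightarrow> u i \<in> borel_measurable (prodM \<mu> {1..i})"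
  by (rule marg_density_measurable[OF fp_measurable])

lemma F_measurable [measurable]:
  assumes [simp]: "i \<le> n" shows "F i \<in> borel_measurable (prodM \<mu> {1..i})"
  unfolding cond_mean_def[abs_def] by measurable

lemma merge_in_Spow:
  assumes "i \<le> n" "z \<in> Spow S i" "x \<in> {i + 1..n} \<rightarrow>\<^sub>E S"
  shows "merge {1..i} {i + 1..n} (z, x) \<in> Spow S n"
  using assms by (auto simp: merge_def PiE_iff extensional_def)

lemma merge_section_measurable:
  assumes "i \<le> n" "z \<in> Spow (space \<mu>) i"
  shows "(\<lambda>x. merge {1..i} {i + 1..n} (z, x)) \<in> measurable (prodM \<mu> {i + 1..n}) (prodM \<mu> {1..n})"
  using merge_prefix_measurable[OF assms(1)] assms(2)
  by (intro measurable_compose[OF measurable_Pair1']) (auto simp: space_PiM)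

lemma u_le:
  assumes i: "i \<le> n" and z: "z \<in> Spow (space \<mu>) i"
  shows "u i z \<le> ennreal B * m i z"
proof -
  note [measurable] = merge_section_measurable[OF i z]
  have "u i z \<le> (\<integral>\<^sup>+x. ennreal B * p (merge {1..i} {i + 1..n} (z, x)) \<partial>prodM \<mu> {i + 1..n})"
    unfolding marg_density_def
    using f_bounds[OF merge_in_Spow[OF i z]]
    by (intro nn_integral_mono mult_right_mono) (auto simp: space_PiM intro!: ennreal_leI)
  also have "\<dots> = ennreal B * m i z"
    unfolding marg_density_def by (rule nn_integral_cmult) measurable
  finally show ?thesis .
qed

text \<open>This also holds where the marginal density vanishes, because the numerator vanishes there too.\<close>

lemma u_eq_F_m:
  assumes i: "i \<le> n" and z: "z \<in> Spow (space \<mu>) i" and fin: "m i z \<noteq> \<infinity>"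
  shows "u i z = ennreal (F i z) * m i z"
proof (cases "m i z = 0")
  case True
  then show ?thesis using u_le[OF i z] by simp
next
  case False
  have "u i z \<noteq> \<infinity>"
    using u_le[OF i z] fin by (auto simp: ennreal_mult_eq_top_iff top_unique)
  then have "u i z / m i z \<noteq> \<infinity>" using False by (simp add: ennreal_divide_eq_top_iff)
  then have "ennreal (F i z) = u i z / m i z" unfolding cond_mean_def by (simp add: less_top)
  then show ?thesis
    using False fin by (simp add: ennreal_divide_times ennreal_divide_self less_top[symmetric])
qed

lemma F_nonneg: "0 \<le> F i z"
  by (simp add: cond_mean_def)

text \<open>For a fixed \<open>y\<close>, the weights \<open>m i (yw) / m (i - 1) y\<close> are the density of the conditional law \<open>Q\<close> of
  \<open>X\<^sub>i\<close>, and \<open>F (i - 1) y\<close> is the \<open>Q\<close>-mean of \<open>w \<mapsto> F i (yw)\<close>.  By the oscillation hypothesis, \<open>F i (yw)\<close> is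
  \<open>Q\<close>-almost surely within \<open>c\<close> of this mean, so Hoeffding's lemma applies to the inner integral.\<close>

lemma mgf_step:
  assumes i: "i \<in> {1..n}" and N: "N \<in> null_sets (law i)"
    and osc: "\<And>y w w'. \<lbrakk>y \<in> Spow (space \<mu>) (i - 1); w \<in> space \<mu>; w' \<in> space \<mu>;
      y(i := w) \<notin> N; y(i := w') \<notin> N\<rbrakk> \<Longrightarrow> \<bar>F i (y(i := w)) - F i (y(i := w'))\<bar> \<le> c"
  shows "(\<integral>\<^sup>+z. exp (l * F i z) * m i z \<partial>prodM \<mu> {1..i}) \<le>
    ennreal (exp (l\<^sup>2 * c\<^sup>2 / 2)) * (\<integral>\<^sup>+y. exp (l * F (i - 1) y) * m (i - 1) y \<partial>prodM \<mu> {1..i - 1})"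
proof -
  let ?K = "ennreal (exp (l\<^sup>2 * c\<^sup>2 / 2))"
  have i': "i \<le> n" "1 \<le> i" "i - 1 \<le> n" using i by auto
  note [measurable] = m_measurable[OF i'(1)] m_measurable[OF i'(3)] u_measurable[OF i'(1)]
    F_measurable[OF i'(1)] F_measurable[OF i'(3)] update_last_measurable[OF i'(2)]
  have N' [measurable]: "N \<in> sets (prodM \<mu> {1..i})" using N by (auto simp: law_def)
  have "(\<integral>\<^sup>+z. m i z * indicator N z \<partial>prodM \<mu> {1..i}) = 0"
    using N by (simp add: law_def null_sets_def emeasure_density)
  then have "(\<integral>\<^sup>+y. \<integral>\<^sup>+w. m i (y(i := w)) * indicator N (y(i := w)) \<partial>\<mu> \<partial>prodM \<mu> {1..i - 1}) = 0"
    using i'(2) by (subst (asm) nn_integral_last_coord) simp_all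
  \<comment> \<open>by Tonelli, almost every section of the null set \<open>N\<close> is null for the conditional law\<close>
  then have N_sections: "AE y in prodM \<mu> {1..i - 1}. (\<integral>\<^sup>+w. m i (y(i := w)) * indicator N (y(i := w)) \<partial>\<mu>) = 0"
    by (subst (asm) nn_integral_0_iff_AE) measurable
  have inner: "(\<integral>\<^sup>+w. ennreal (exp (l * F i (y(i := w)))) * m i (y(i := w)) \<partial>\<mu>)
      \<le> ?K * (ennreal (exp (l * F (i - 1) y)) * m (i - 1) y)"
    if y: "y \<in> space (prodM \<mu> {1..i - 1})" and fin: "m (i - 1) y \<noteq> \<infinity>"
      and null: "(\<integral>\<^sup>+w. m i (y(i := w)) * indicator N (y(i := w)) \<partial>\<mu>) = 0" for y
  proof -
    have yS: "y \<in> Spow (space \<mu>) (i - 1)" using y by (simp add: space_PiM)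
    have up [measurable]: "(\<lambda>w. y(i := w)) \<in> measurable \<mu> (prodM \<mu> {1..i})"
      using measurable_compose[OF measurable_Pair1'[OF y] update_last_measurable[OF i'(2)]] by simp
    have upS: "y(i := w) \<in> Spow (space \<mu>) i" if "w \<in> space \<mu>" for w
      using measurable_space[OF up that] by (simp add: space_PiM)
    define g where "g w = m i (y(i := w))" for w
    define X where "X w = F i (y(i := w))" for w
    have [measurable]: "g \<in> borel_measurable \<mu>" "X \<in> borel_measurable \<mu>"
      unfolding g_def X_def by measurable
    have int_g: "(\<integral>\<^sup>+w. g w \<partial>\<mu>) = m (i - 1) y"
      unfolding g_def by (rule marg_density_step[OF p_measurable i yS, symmetric])
    have g_fin: "AE w in \<mu>. g w \<noteq> \<infinity>"
      by (rule nn_integral_PInf_AE) (use fin in \<open>simp_all add: int_g\<close>)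
    have int_Xg: "(\<integral>\<^sup>+w. ennreal (X w) * g w \<partial>\<mu>) = u (i - 1) y"
    proof -
      have "(\<integral>\<^sup>+w. ennreal (X w) * g w \<partial>\<mu>) = (\<integral>\<^sup>+w. u i (y(i := w)) \<partial>\<mu>)"
      proof (rule nn_integral_cong_AE)
        show "AE w in \<mu>. ennreal (X w) * g w = u i (y(i := w))"
          using g_fin AE_space
          by eventually_elim (simp add: g_def X_def u_eq_F_m[OF i'(1) upS])
      qed
      then show ?thesis using marg_density_step[OF fp_measurable i yS] by simp
    qed
    show ?thesis
    proof (cases "m (i - 1) y = 0")
      case True
      then have "AE w in \<mu>. g w = 0" using int_g nn_integral_0_iff_AE[of g \<mu>] by simp
      then have "(\<integral>\<^sup>+w. ennreal (exp (l * X w)) * g w \<partial>\<mu>) = (\<integral>\<^sup>+w. 0 \<partial>\<mu>)"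
        by (intro nn_integral_cong_AE) auto
      then show ?thesis by (simp add: g_def X_def)
    next
      case False
      define M0 where "M0 = m (i - 1) y"
      have M0: "M0 \<noteq> 0" "M0 \<noteq> \<infinity>" using False fin by (auto simp: M0_def)
      define Q where "Q = density \<mu> (\<lambda>w. g w / M0)"
      have Qint: "(\<integral>\<^sup>+w. h w \<partial>Q) = (\<integral>\<^sup>+w. h w * g w \<partial>\<mu>) / M0"
        if [measurable]: "h \<in> borel_measurable \<mu>" for h
      proof -
        have "(\<integral>\<^sup>+w. h w \<partial>Q) = (\<integral>\<^sup>+w. g w / M0 * h w \<partial>\<mu>)"
          unfolding Q_def by (rule nn_integral_density) measurable
        also have "\<dots> = (\<integral>\<^sup>+w. h w * g w / M0 \<partial>\<mu>)"
          by (simp add: ennreal_times_divide mult.commute)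
        also have "\<dots> = (\<integral>\<^sup>+w. h w * g w \<partial>\<mu>) / M0"
          by (rule nn_integral_divide) measurable
        finally show ?thesis .
      qed
      interpret Q: prob_space Q
      proof
        have "emeasure Q (space Q) = (\<integral>\<^sup>+w. 1 \<partial>Q)" by simp
        also have "\<dots> = 1" using M0 by (subst Qint) (simp_all add: int_g M0_def ennreal_divide_self less_top)
        finally show "emeasure Q (space Q) = 1" .
      qed
      have [measurable]: "X \<in> borel_measurable Q" by (simp add: Q_def)
      have "(\<integral>\<^sup>+w. ennreal (X w) \<partial>Q) = u (i - 1) y / M0"
        by (subst Qint) (simp_all add: int_Xg)
      also have "\<dots> = ennreal (F (i - 1) y)"
        using u_eq_F_m[OF i'(3) yS] fin M0
        by (simp add: M0_def[symmetric] ennreal_mult_divide_eq)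
      finally have nnX: "(\<integral>\<^sup>+w. ennreal (X w) \<partial>Q) = ennreal (F (i - 1) y)" .
      have X0: "0 \<le> X w" for w by (simp add: X_def F_nonneg)
      have EX: "Q.expectation X = F (i - 1) y"
        by (subst integral_eq_nn_integral) (simp_all add: X0 nnX F_nonneg)
      have intX: "integrable Q X"
        by (rule integrableI_nonneg) (simp_all add: X0 nnX)
      have good: "AE w in Q. w \<in> space \<mu> \<and> y(i := w) \<notin> N"
      proof -
        have "AE w in \<mu>. m i (y(i := w)) * indicator N (y(i := w)) = 0"
          using null by (subst (asm) nn_integral_0_iff_AE) measurable
        then have "AE w in \<mu>. 0 < g w / M0 \<longrightarrow> w \<in> space \<mu> \<and> y(i := w) \<notin> N"
          by (rule AE_mp) (auto intro!: AE_I2 simp: g_def indicator_def split: if_splits)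
        then show ?thesis unfolding Q_def by (subst AE_density) measurable
      qed
      have "AE w in Q. \<bar>X w - Q.expectation X\<bar> \<le> c"
        using good
      proof (rule AE_mp, intro AE_I2 impI)
        fix w assume w: "w \<in> space \<mu> \<and> y(i := w) \<notin> N"
        have "AE w' in Q. \<bar>X w' - X w\<bar> \<le> c"
          using good by eventually_elim (use osc[OF yS] w in \<open>auto simp: X_def\<close>)
        then have *: "AE w' in Q. X w' \<le> X w + c" "AE w' in Q. X w - c \<le> X w'"
          by (auto elim!: eventually_mono)
        have "Q.expectation X \<le> Q.expectation (\<lambda>_. X w + c)"
          using intX *(1) by (intro integral_mono_AE) auto
        moreover have "Q.expectation (\<lambda>_. X w - c) \<le> Q.expectation X"
          using intX *(2) by (intro integral_mono_AE) auto
        ultimately show "\<bar>X w - Q.expectation X\<bar> \<le> c" by (simp add: Q.prob_space abs_le_iff)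
      qed
      then have "(\<integral>\<^sup>+w. exp (l * (X w - F (i - 1) y)) \<partial>Q) \<le> ?K"
        using Q.Hoeffding_lemma_centred[of X c l] by (simp add: EX)
      then have "(\<integral>\<^sup>+w. ennreal (exp (l * (X w - F (i - 1) y))) * g w \<partial>\<mu>) / M0 \<le> ?K"
        by (subst (asm) Qint) simp_all
      then have "(\<integral>\<^sup>+w. ennreal (exp (l * (X w - F (i - 1) y))) * g w \<partial>\<mu>) / M0 * M0 \<le> ?K * M0"
        by (rule mult_right_mono) simp
      then have bd: "(\<integral>\<^sup>+w. ennreal (exp (l * (X w - F (i - 1) y))) * g w \<partial>\<mu>) \<le> ?K * M0"
        using M0 by (simp add: ennreal_divide_times ennreal_divide_self less_top[symmetric])
      have "(\<integral>\<^sup>+w. ennreal (exp (l * X w)) * g w \<partial>\<mu>)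
          = (\<integral>\<^sup>+w. ennreal (exp (l * F (i - 1) y)) * (ennreal (exp (l * (X w - F (i - 1) y))) * g w) \<partial>\<mu>)"
        by (simp add: ennreal_exp_mult algebra_simps)
      also have "\<dots> = ennreal (exp (l * F (i - 1) y)) * (\<integral>\<^sup>+w. ennreal (exp (l * (X w - F (i - 1) y))) * g w \<partial>\<mu>)"
        by (rule nn_integral_cmult) measurable
      also have "\<dots> \<le> ennreal (exp (l * F (i - 1) y)) * (?K * M0)"
        by (rule mult_left_mono[OF bd]) simp
      finally show ?thesis by (simp add: g_def X_def M0_def mult_ac)
    qed
  qed
  have "(\<integral>\<^sup>+z. exp (l * F i z) * m i z \<partial>prodM \<mu> {1..i})
      = (\<integral>\<^sup>+y. \<integral>\<^sup>+w. ennreal (exp (l * F i (y(i := w)))) * m i (y(i := w)) \<partial>\<mu> \<partial>prodM \<mu> {1..i - 1})"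
    using i'(2) by (subst nn_integral_last_coord) simp_all
  also have "\<dots> \<le> (\<integral>\<^sup>+y. ?K * (ennreal (exp (l * F (i - 1) y)) * m (i - 1) y) \<partial>prodM \<mu> {1..i - 1})"
  proof (rule nn_integral_mono_AE)
    show "AE y in prodM \<mu> {1..i - 1}.
        (\<integral>\<^sup>+w. ennreal (exp (l * F i (y(i := w)))) * m i (y(i := w)) \<partial>\<mu>)
        \<le> ?K * (ennreal (exp (l * F (i - 1) y)) * m (i - 1) y)"
      using N_sections AE_m_finite[OF i'(3)] AE_space by eventually_elim (rule inner)
  qed
  also have "\<dots> = ?K * (\<integral>\<^sup>+y. exp (l * F (i - 1) y) * m (i - 1) y \<partial>prodM \<mu> {1..i - 1})"
    by (rule nn_integral_cmult) measurable
  finally show ?thesis .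
qed

text \<open>Start from \<open>F n = f\<close>, which holds almost surely, and end at the constant \<open>F 0 = E f\<close> on the one-point
  space \<open>S\<^sup>0\<close>; each of the \<open>n\<close> steps costs a factor \<open>exp(l\<^sup>2 c\<^sup>2 / 2)\<close>.\<close>

lemma mgf_bound:
  assumes N: "\<And>i. i \<in> {1..n} \<Longrightarrow> N i \<in> null_sets (law i)"
    and osc: "\<And>i y w w'. \<lbrakk>i \<in> {1..n}; y \<in> Spow (space \<mu>) (i - 1); w \<in> space \<mu>; w' \<in> space \<mu>;
      y(i := w) \<notin> N i; y(i := w') \<notin> N i\<rbrakk> \<Longrightarrow> \<bar>F i (y(i := w)) - F i (y(i := w'))\<bar> \<le> c"
  shows "(\<integral>\<^sup>+x. exp (l * (f x - (\<integral>x. f x \<partial>law n))) \<partial>law n) \<le> ennreal (exp (l\<^sup>2 * (real n * c\<^sup>2) / 2))"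
proof -
  let ?K = "l\<^sup>2 * c\<^sup>2 / 2"
  let ?G = "\<lambda>i. \<integral>\<^sup>+z. exp (l * F i z) * m i z \<partial>prodM \<mu> {1..i}"
  define e where "e = (\<lambda>_::nat. undefined :: 'a)"
  have "?G i \<le> ennreal (exp (real i * ?K)) * ?G 0" if "i \<le> n" for i
    using that
  proof (induction i)
    case (Suc i)
    have "?G (Suc i) \<le> ennreal (exp ?K) * ?G (Suc i - 1)"
      using Suc.prems by (intro mgf_step[where N = "N (Suc i)"] N osc) auto
    also have "\<dots> \<le> ennreal (exp ?K) * (ennreal (exp (real i * ?K)) * ?G 0)"
      using Suc by (intro mult_left_mono) auto
    also have "\<dots> = ennreal (exp (real (Suc i) * ?K)) * ?G 0"
      by (simp add: ennreal_exp_mult algebra_simps add_divide_distrib)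
    finally show ?case .
  qed simp
  then have G: "?G n \<le> ennreal (exp (real n * ?K)) * ?G 0" by simp
  have e: "(\<integral>\<^sup>+z. h z \<partial>prodM \<mu> {}) = h e" for h
    by (simp add: PiM_empty e_def nn_integral_count_space_finite)
  have eS: "e \<in> Spow (space \<mu>) 0" by (simp add: e_def)
  have m0: "m 0 e = 1"
    using nn_integral_marg_density[OF p_measurable, of 0]
    by (simp add: e p_prob)
  have u0: "u 0 e = (\<integral>\<^sup>+x. ennreal (f x) * p x \<partial>prodM \<mu> {1..n})"
    using nn_integral_marg_density[OF fp_measurable, of 0]
    by (simp add: e)
  have "(\<integral>\<^sup>+x. ennreal (f x) \<partial>law n) = u 0 e"
    unfolding law_full u0 by (subst nn_integral_density) (simp_all add: mult.commute)
  also have "\<dots> = ennreal (F 0 e)" using u_eq_F_m[of 0 e] eS m0 by simp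
  finally have "(\<integral>\<^sup>+x. ennreal (f x) \<partial>law n) = ennreal (F 0 e)" .
  moreover have "AE x in law n. 0 \<le> f x"
    using f_bounds by (intro AE_I2) (simp add: law_def space_PiM)
  ultimately have F0: "(\<integral>x. f x \<partial>law n) = F 0 e"
    by (subst integral_eq_nn_integral) (simp_all add: F_nonneg law_full)
  have G0: "?G 0 = ennreal (exp (l * F 0 e))"
    by (simp add: e m0)
  have Fn: "F n x = f x" if "x \<in> Spow (space \<mu>) n" "0 < p x" "p x \<noteq> \<infinity>" for x
  proof -
    have "merge {1..n} {n + 1..n} (x, y) = x" for y
      using that(1) by (auto simp: merge_def fun_eq_iff PiE_def extensional_def)
    then have "u n x = ennreal (f x) * p x"
      by (simp add: marg_density_def PiM_empty nn_integral_count_space_finite)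
    then show ?thesis
      using that f_bounds[OF that(1)]
      by (simp add: cond_mean_def m_full ennreal_mult_divide_eq)
  qed
  have "(\<integral>\<^sup>+x. exp (l * f x) \<partial>law n) = (\<integral>\<^sup>+x. p x * exp (l * f x) \<partial>prodM \<mu> {1..n})"
    unfolding law_full by (rule nn_integral_density) measurable
  also have "\<dots> = ?G n"
  proof (rule nn_integral_cong_AE)
    show "AE x in prodM \<mu> {1..n}. p x * ennreal (exp (l * f x)) = ennreal (exp (l * F n x)) * m n x"
      using AE_m_finite[OF order_refl] AE_space
    proof eventually_elim
      fix x assume x: "m n x \<noteq> \<infinity>" "x \<in> space (prodM \<mu> {1..n})"
      then show "p x * ennreal (exp (l * f x)) = ennreal (exp (l * F n x)) * m n x"
        using Fn[of x] by (cases "p x = 0") (auto simp: m_full space_PiM mult.commute zero_less_iff_neq_zero)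
    qed
  qed
  finally have fG: "(\<integral>\<^sup>+x. exp (l * f x) \<partial>law n) = ?G n" .
  have "(\<integral>\<^sup>+x. exp (l * (f x - (\<integral>x. f x \<partial>law n))) \<partial>law n)
      = (\<integral>\<^sup>+x. ennreal (exp (- (l * F 0 e))) * ennreal (exp (l * f x)) \<partial>law n)"
    by (simp add: F0 ennreal_exp_mult algebra_simps)
  also have "\<dots> = ennreal (exp (- (l * F 0 e))) * ?G n"
    unfolding fG[symmetric] by (rule nn_integral_cmult) (simp add: law_full)
  also have "\<dots> \<le> ennreal (exp (- (l * F 0 e))) * (ennreal (exp (real n * ?K)) * ?G 0)"
    by (rule mult_left_mono[OF G]) simp
  also have "\<dots> = ennreal (exp (l\<^sup>2 * (real n * c\<^sup>2) / 2))"
    unfolding G0 ennreal_exp_mult by (simp add: algebra_simps)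
  finally show ?thesis .
qed

end

section \<open>Total variation\<close>

text \<open>Test the supremum on the partition into \<open>A\<close> and its complement.  The two contribute equally, because
  both measures have the same total mass; this compensates the factor \<open>1/2\<close>.\<close>

lemma tv_norm_ge_difference:
  assumes Q: "prob_space Q" "sets Q = sets M" and R: "prob_space R" "sets R = sets M"
    and A: "A \<in> sets M"
  shows "ennreal \<bar>measure Q A - measure R A\<bar> \<le> tv_norm M (\<lambda>A. measure Q A - measure R A)"
proof -
  interpret Q: prob_space Q by fact
  interpret R: prob_space R by fact
  have sp: "space Q = space M" "space R = space M" using sets_eq_imp_space_eq[OF Q(2)] sets_eq_imp_space_eq[OF R(2)] by simp_all
  let ?\<tau> = "\<lambda>A. measure Q A - measure R A"
  define E where "E = (\<lambda>i::nat. if i = 0 then A else if i = 1 then space M - A else {})"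
  have compl: "?\<tau> (space M - A) = - ?\<tau> A"
    using Q.prob_compl[of A] R.prob_compl[of A] A Q(2) R(2) sp by simp
  have E: "range E \<subseteq> sets M" "disjoint_family E" "(\<Union>i. E i) = space M"
    using A sets.sets_into_space[OF A]
    by (auto simp: E_def disjoint_family_on_def split: if_splits)
  have "2 * ennreal \<bar>?\<tau> A\<bar> = (\<Sum>i<2. ennreal \<bar>?\<tau> (E i)\<bar>)"
    using compl by (simp add: E_def numeral_2_eq_2 mult_2)
  also have "\<dots> \<le> (\<Sum>i. ennreal \<bar>?\<tau> (E i)\<bar>)"
    by (intro sum_le_suminf) auto
  also have "\<dots> \<le> (SUP E\<in>{E :: nat \<Rightarrow> _ set. range E \<subseteq> sets M \<and> disjoint_family E \<and> (\<Union>i. E i) = space M}.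
        \<Sum>i. ennreal \<bar>?\<tau> (E i)\<bar>)"
    using E by (intro SUP_upper) auto
  finally have "2 * ennreal \<bar>?\<tau> A\<bar> / 2 \<le> tv_norm M ?\<tau>"
    unfolding tv_norm_def by (rule divide_right_mono_ennreal)
  moreover have "2 * a / 2 = a" for a :: ennreal
    using mult_divide_eq_ennreal[of 2 a] by (simp add: mult.commute)
  ultimately show ?thesis by simp
qed

lemma tv_norm_le_1:
  assumes Q: "prob_space Q" "sets Q = sets M" and R: "prob_space R" "sets R = sets M"
  shows "tv_norm M (\<lambda>A. measure Q A - measure R A) \<le> 1"
proof -
  interpret Q: prob_space Q by fact
  interpret R: prob_space R by fact
  have sp: "space Q = space M" "space R = space M" using sets_eq_imp_space_eq[OF Q(2)] sets_eq_imp_space_eq[OF R(2)] by simp_all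
  have "(SUP E\<in>{E :: nat \<Rightarrow> _ set. range E \<subseteq> sets M \<and> disjoint_family E \<and> (\<Union>i. E i) = space M}.
        \<Sum>i. ennreal \<bar>measure Q (E i) - measure R (E i)\<bar>) \<le> 2"
  proof (rule SUP_least)
    fix E :: "nat \<Rightarrow> _ set"
    assume "E \<in> {E. range E \<subseteq> sets M \<and> disjoint_family E \<and> (\<Union>i. E i) = space M}"
    then have E: "range E \<subseteq> sets M" "disjoint_family E" "(\<Union>i. E i) = space M" by auto
    have "(\<Sum>i. ennreal \<bar>measure Q (E i) - measure R (E i)\<bar>) \<le> (\<Sum>i. emeasure Q (E i) + emeasure R (E i))"
    proof (intro suminf_le)
      fix i
      have "\<bar>measure Q (E i) - measure R (E i)\<bar> \<le> measure Q (E i) + measure R (E i)"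
        using measure_nonneg[of Q "E i"] measure_nonneg[of R "E i"] by linarith
      then show "ennreal \<bar>measure Q (E i) - measure R (E i)\<bar> \<le> emeasure Q (E i) + emeasure R (E i)"
        unfolding Q.emeasure_eq_measure R.emeasure_eq_measure
        by (subst ennreal_plus[OF measure_nonneg measure_nonneg, symmetric]) (rule ennreal_leI)
    qed auto
    also have "\<dots> = (\<Sum>i. emeasure Q (E i)) + (\<Sum>i. emeasure R (E i))"
      by (rule suminf_add[symmetric]) auto
    also have "\<dots> = 2"
      using E Q(2) R(2) sp Q.emeasure_space_1 R.emeasure_space_1
      by (subst (1 2) suminf_emeasure) auto
    finally show "(\<Sum>i. ennreal \<bar>measure Q (E i) - measure R (E i)\<bar>) \<le> 2" .
  qed
  then have "tv_norm M (\<lambda>A. measure Q A - measure R A) \<le> 2 / 2"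
    unfolding tv_norm_def by (rule divide_right_mono_ennreal)
  then show ?thesis by (simp add: ennreal_divide_self)
qed

section \<open>Oscillation of conditional means\<close>

context coordinate_density
begin

text \<open>The points at which the conditional law is a probability measure.\<close>

definition regular :: "nat \<Rightarrow> (nat \<Rightarrow> 'a) \<Rightarrow> bool" where
  "regular i z \<longleftrightarrow> z \<in> Spow (space \<mu>) i \<and> m i z \<noteq> 0 \<and> m i z \<noteq> \<infinity>"

text \<open>A real version of the conditional density, which is finite almost everywhere at regular points.
  Differences of two conditional densities only make sense over the reals.\<close>

definition cond_dens :: "nat \<Rightarrow> (nat \<Rightarrow> 'a) \<Rightarrow> (nat \<Rightarrow> 'a) \<Rightarrow> real" where
  "cond_dens i z x = enn2real (p (merge {1..i} {i + 1..n} (z, x)) / m i z)"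

lemma cond_dens_nonneg: "0 \<le> cond_dens i z x"
  by (simp add: cond_dens_def)

context
  fixes i z
  assumes i: "i \<le> n" and z: "regular i z"
begin

lemma merge_regular_measurable [measurable]:
  "(\<lambda>x. merge {1..i} {i + 1..n} (z, x)) \<in> measurable (prodM \<mu> {i + 1..n}) (prodM \<mu> {1..n})"
  using merge_prefix_measurable[OF i] z
  by (intro measurable_compose[OF measurable_Pair1']) (auto simp: space_PiM regular_def)

lemma cond_dens_measurable [measurable]:
  "cond_dens i z \<in> borel_measurable (prodM \<mu> {i + 1..n})"
  unfolding cond_dens_def by measurable

lemma nn_integral_cond_dens_ennreal:
  "(\<integral>\<^sup>+x. p (merge {1..i} {i + 1..n} (z, x)) / m i z \<partial>prodM \<mu> {i + 1..n}) = 1"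
proof -
  have "(\<integral>\<^sup>+x. p (merge {1..i} {i + 1..n} (z, x)) / m i z \<partial>prodM \<mu> {i + 1..n}) = m i z / m i z"
    by (subst nn_integral_divide) (auto simp: marg_density_def)
  then show ?thesis using z by (simp add: regular_def ennreal_divide_self less_top[symmetric])
qed

lemma AE_cond_dens:
  "AE x in prodM \<mu> {i + 1..n}. ennreal (cond_dens i z x) = p (merge {1..i} {i + 1..n} (z, x)) / m i z"
proof -
  have "AE x in prodM \<mu> {i + 1..n}. p (merge {1..i} {i + 1..n} (z, x)) / m i z \<noteq> \<infinity>"
    by (rule nn_integral_PInf_AE) (use nn_integral_cond_dens_ennreal in auto)
  then show ?thesis by (rule AE_mp) (auto intro!: AE_I2 simp: cond_dens_def less_top[symmetric])
qed

lemma nn_integral_cond_dens: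
  "(\<integral>\<^sup>+x. ennreal (cond_dens i z x) \<partial>prodM \<mu> {i + 1..n}) = 1"
  by (subst nn_integral_cong_AE[OF AE_cond_dens]) (rule nn_integral_cond_dens_ennreal)

lemma integrable_cond_dens: "integrable (prodM \<mu> {i + 1..n}) (cond_dens i z)"
  by (rule integrableI_nonneg) (auto simp: cond_dens_nonneg nn_integral_cond_dens)

lemma integral_cond_dens: "(\<integral>x. cond_dens i z x \<partial>prodM \<mu> {i + 1..n}) = 1"
  by (subst integral_eq_nn_integral) (auto simp: cond_dens_nonneg nn_integral_cond_dens)

lemma integrable_cond_dens_mult:
  assumes [measurable]: "h \<in> borel_measurable (prodM \<mu> {i + 1..n})"
    and bd: "\<And>x. x \<in> space (prodM \<mu> {i + 1..n}) \<Longrightarrow> \<bar>h x\<bar> \<le> C"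
  shows "integrable (prodM \<mu> {i + 1..n}) (\<lambda>x. cond_dens i z x * h x)"
proof (rule Bochner_Integration.integrable_bound)
  show "integrable (prodM \<mu> {i + 1..n}) (\<lambda>x. C * cond_dens i z x)"
    using integrable_cond_dens by simp
  show "AE x in prodM \<mu> {i + 1..n}. norm (cond_dens i z x * h x) \<le> norm (C * cond_dens i z x)"
  proof (rule AE_I2)
    fix x assume "x \<in> space (prodM \<mu> {i + 1..n})"
    then have "\<bar>h x\<bar> \<le> \<bar>C\<bar>" using bd by fastforce
    then show "norm (cond_dens i z x * h x) \<le> norm (C * cond_dens i z x)"
      by (auto simp: abs_mult mult.commute intro!: mult_right_mono)
  qed
qed measurable

lemma nn_integral_cond_law_density:
  assumes [measurable]: "h \<in> borel_measurable (prodM \<mu> {i + 1..n})"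
    and bd: "\<And>x. x \<in> space (prodM \<mu> {i + 1..n}) \<Longrightarrow> 0 \<le> h x \<and> h x \<le> C"
  shows "(\<integral>\<^sup>+x. ennreal (h x) * (p (merge {1..i} {i + 1..n} (z, x)) / m i z) \<partial>prodM \<mu> {i + 1..n})
    = ennreal (\<integral>x. cond_dens i z x * h x \<partial>prodM \<mu> {i + 1..n})"
proof -
  have "(\<integral>\<^sup>+x. ennreal (h x) * (p (merge {1..i} {i + 1..n} (z, x)) / m i z) \<partial>prodM \<mu> {i + 1..n})
      = (\<integral>\<^sup>+x. ennreal (cond_dens i z x * h x) \<partial>prodM \<mu> {i + 1..n})"
  proof (rule nn_integral_cong_AE)
    show "AE x in prodM \<mu> {i + 1..n}. ennreal (h x) * (p (merge {1..i} {i + 1..n} (z, x)) / m i z)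
        = ennreal (cond_dens i z x * h x)"
      using AE_cond_dens AE_space
    proof eventually_elim
      fix x assume x: "ennreal (cond_dens i z x) = p (merge {1..i} {i + 1..n} (z, x)) / m i z"
        "x \<in> space (prodM \<mu> {i + 1..n})"
      show "ennreal (h x) * (p (merge {1..i} {i + 1..n} (z, x)) / m i z) = ennreal (cond_dens i z x * h x)"
        unfolding x(1)[symmetric] using bd[OF x(2)]
        by (simp add: ennreal_mult cond_dens_nonneg mult.commute)
    qed
  qed
  also have "\<dots> = ennreal (\<integral>x. cond_dens i z x * h x \<partial>prodM \<mu> {i + 1..n})"
    using bd by (intro nn_integral_eq_integral integrable_cond_dens_mult[where C = C])
      (auto intro!: AE_I2 simp: cond_dens_nonneg)
  finally show ?thesis .
qed

lemma
  assumes j: "i < j"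
  shows prob_space_cond_law: "prob_space (cond_law \<mu> p n i j z)"
    and measure_cond_law: "A \<in> sets (prodM \<mu> {j..n}) \<Longrightarrow> measure (cond_law \<mu> p n i j z) A =
      (\<integral>x. cond_dens i z x * indicator A (restrict x {j..n}) \<partial>prodM \<mu> {i + 1..n})"
proof -
  have res [measurable]: "(\<lambda>x. restrict x {j..n}) \<in> measurable (prodM \<mu> {i + 1..n}) (prodM \<mu> {j..n})"
    using j by (intro measurable_restrict_subset) auto
  let ?D = "density (prodM \<mu> {i + 1..n}) (\<lambda>x. p (merge {1..i} {i + 1..n} (z, x)) / m i z)"
  have "emeasure ?D (space ?D) = 1"
    using nn_integral_cond_dens_ennreal by (simp add: emeasure_density cong: nn_integral_cong)
  then have "prob_space ?D" by (rule prob_spaceI)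
  then show "prob_space (cond_law \<mu> p n i j z)"
    unfolding cond_law_def by (rule prob_space.prob_space_distr) simp
  assume A [measurable]: "A \<in> sets (prodM \<mu> {j..n})"
  have "emeasure (cond_law \<mu> p n i j z) A = (\<integral>\<^sup>+v. indicator A v \<partial>cond_law \<mu> p n i j z)"
    using A by (simp add: cond_law_def)
  also have "\<dots> = (\<integral>\<^sup>+x. indicator A (restrict x {j..n}) \<partial>?D)"
    unfolding cond_law_def by (rule nn_integral_distr) simp_all
  also have "\<dots> = (\<integral>\<^sup>+x. p (merge {1..i} {i + 1..n} (z, x)) / m i z * indicator A (restrict x {j..n})
      \<partial>prodM \<mu> {i + 1..n})"
    by (rule nn_integral_density) measurable
  also have "\<dots> = (\<integral>\<^sup>+x. ennreal (indicator A (restrict x {j..n})) * (p (merge {1..i} {i + 1..n} (z, x)) / m i z)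
      \<partial>prodM \<mu> {i + 1..n})"
    by (intro nn_integral_cong) (auto simp: indicator_def)
  also have "\<dots> = ennreal (\<integral>x. cond_dens i z x * indicator A (restrict x {j..n}) \<partial>prodM \<mu> {i + 1..n})"
    by (rule nn_integral_cond_law_density[where C = 1]) (auto simp: indicator_def)
  finally show "measure (cond_law \<mu> p n i j z) A =
      (\<integral>x. cond_dens i z x * indicator A (restrict x {j..n}) \<partial>prodM \<mu> {i + 1..n})"
    by (rule measure_eq_emeasure_eq_ennreal[rotated]) (auto intro!: integral_nonneg simp: cond_dens_nonneg)
qed

end

lemma sets_cond_law: "sets (cond_law \<mu> p n i j z) = sets (prodM \<mu> {j..n})"
  by (simp add: cond_law_def)

lemma eta_le_1:
  assumes "i < j" "i \<le> n" "regular i (y(i := w))" "regular i (y(i := w'))"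
  shows "eta \<mu> p n i j y w w' \<le> 1"
  unfolding eta_def using assms by (intro tv_norm_le_1 prob_space_cond_law sets_cond_law) auto

lemma cond_law_difference_le_eta:
  assumes "i < j" "i \<le> n" "regular i (y(i := w))" "regular i (y(i := w'))" and A: "A \<in> sets (prodM \<mu> {j..n})"
  shows "measure (cond_law \<mu> p n i j (y(i := w))) A - measure (cond_law \<mu> p n i j (y(i := w'))) A
    \<le> enn2real (eta \<mu> p n i j y w w')"
proof -
  let ?d = "measure (cond_law \<mu> p n i j (y(i := w))) A - measure (cond_law \<mu> p n i j (y(i := w'))) A"
  have "ennreal \<bar>?d\<bar> \<le> eta \<mu> p n i j y w w'"
    unfolding eta_def using assms by (intro tv_norm_ge_difference prob_space_cond_law sets_cond_law) auto
  moreover have "eta \<mu> p n i j y w w' < \<infinity>"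
    using eta_le_1[OF assms(1-4)] by (simp add: le_less_trans)
  ultimately have "enn2real (ennreal \<bar>?d\<bar>) \<le> enn2real (eta \<mu> p n i j y w w')"
    by (intro enn2real_mono) auto
  then show ?thesis by simp
qed

end

text \<open>The hypotheses under which the conditional means of a bounded \<open>L\<close>-Lipschitz function have small
  oscillation.\<close>

locale dominated_observable = bounded_observable \<mu> n p f B + deletion_metrics n "space \<mu>" \<rho>
  for \<mu> :: "'a measure" and n :: nat and p :: "(nat \<Rightarrow> 'a) \<Rightarrow> ennreal"
    and f :: "(nat \<Rightarrow> 'a) \<Rightarrow> real" and B :: real
    and \<rho> :: "nat \<Rightarrow> (nat \<Rightarrow> 'a) \<Rightarrow> (nat \<Rightarrow> 'a) \<Rightarrow> real" +
  fixes L :: real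
  assumes L: "0 < L"
    and lipschitz: "\<lbrakk>x \<in> Spow (space \<mu>) n; y \<in> Spow (space \<mu>) n\<rbrakk> \<Longrightarrow> \<bar>f x - f y\<bar> \<le> L * \<rho> n x y"
    and dominated: "\<lbrakk>k \<in> {1..n}; integrable (prodM \<mu> {1..k}) H; g \<in> Lip (Spow (space \<mu>) k) (\<rho> k)\<rbrakk> \<Longrightarrow>
      (\<integral>x. H x * g x \<partial>prodM \<mu> {1..k}) \<le> Psi \<mu> k H"
begin

lemma F_eq_integral:
  assumes i: "i \<le> n" and z: "regular i z"
  shows "F i z = (\<integral>x. cond_dens i z x * f (merge {1..i} {i + 1..n} (z, x)) \<partial>prodM \<mu> {i + 1..n})"
proof -
  note [measurable] = merge_regular_measurable[OF i z]
  have zS: "z \<in> Spow (space \<mu>) i" using z by (simp add: regular_def)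
  have fb: "0 \<le> f (merge {1..i} {i + 1..n} (z, x)) \<and> f (merge {1..i} {i + 1..n} (z, x)) \<le> B"
    if "x \<in> space (prodM \<mu> {i + 1..n})" for x
    using that by (intro f_bounds merge_in_Spow i zS) (simp add: space_PiM)
  have "u i z / m i z = (\<integral>\<^sup>+x. ennreal (f (merge {1..i} {i + 1..n} (z, x))) *
      (p (merge {1..i} {i + 1..n} (z, x)) / m i z) \<partial>prodM \<mu> {i + 1..n})"
    unfolding marg_density_def[of \<mu> "\<lambda>x. ennreal (f x) * p x"]
    by (subst nn_integral_divide[symmetric]) (auto simp: ennreal_times_divide)
  also have "\<dots> = ennreal (\<integral>x. cond_dens i z x * f (merge {1..i} {i + 1..n} (z, x)) \<partial>prodM \<mu> {i + 1..n})"
    by (rule nn_integral_cond_law_density[OF i z _ fb]) measurable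
  finally show ?thesis
    unfolding cond_mean_def using fb
    by (auto intro!: enn2real_ennreal Bochner_Integration.integral_nonneg simp: cond_dens_nonneg)
qed

text \<open>The contribution of changing the conditional law while keeping the function \<open>f(yw\<cdot>)\<close>.\<close>

lemma tail_variation:
  assumes i: "i \<in> {1..n}" and z: "regular i (y(i := w))" and z': "regular i (y(i := w'))"
  defines "h \<equiv> \<lambda>x. cond_dens i (y(i := w)) x - cond_dens i (y(i := w')) x"
  shows "(\<integral>x. h x * f (merge {1..i} {i + 1..n} (y(i := w), x)) \<partial>prodM \<mu> {i + 1..n})
    \<le> L * (\<Sum>j\<in>{i + 1..n}. enn2real (eta \<mu> p n i j y w w'))"
proof -
  define z where "z = y(i := w)"
  have i': "i \<le> n" "1 \<le> i" using i by auto
  have zS: "z \<in> Spow (space \<mu>) i" using z by (simp add: z_def regular_def)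
  note [measurable] = merge_regular_measurable[OF i'(1) assms(2), folded z_def]
  note [measurable] = cond_dens_measurable[OF i'(1) z] cond_dens_measurable[OF i'(1) z']
  have h_int: "integrable (prodM \<mu> {i + 1..n}) h"
    unfolding h_def by (intro Bochner_Integration.integrable_diff integrable_cond_dens i' z z')
  have h_0: "(\<integral>x. h x \<partial>prodM \<mu> {i + 1..n}) = 0"
    unfolding h_def
    using integrable_cond_dens[OF i'(1) z] integrable_cond_dens[OF i'(1) z']
    by (simp add: integral_cond_dens i' z z')
  show ?thesis
  proof (cases "i = n")
    case True
    have "merge {1..i} {i + 1..n} (z, x) = z" for x
      using zS True by (auto simp: merge_def fun_eq_iff PiE_def extensional_def)
    then have "(\<integral>x. h x * f (merge {1..i} {i + 1..n} (y(i := w), x)) \<partial>prodM \<mu> {i + 1..n}) = 0"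
      using h_0 by (simp add: z_def)
    then show ?thesis using True by simp
  next
    case False
    define k where "k = n - i"
    have k: "k \<in> {1..n}" "i + k = n" using False i by (auto simp: k_def)
    \<comment> \<open>\<open>\<Psi>\<close> is defined on \<open>S\<^sup>k\<close> with coordinates \<open>{1..k}\<close>, whereas \<open>h\<close> lives on the coordinates \<open>{i + 1..n}\<close>\<close>
    define r where "r = (\<lambda>x::nat \<Rightarrow> 'a. \<lambda>m\<in>{i + 1..n}. x (m - i))"
    have bij: "bij_betw (\<lambda>m. m - i) {i + 1..n} {1..k}"
      by (rule bij_betw_byWitness[where f' = "\<lambda>m. m + i"]) (auto simp: k_def)
    have distr: "distr (prodM \<mu> {1..k}) (prodM \<mu> {i + 1..n}) r = prodM \<mu> {i + 1..n}"
      unfolding r_def by (rule distr_prodM_reindex[OF bij]) simp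
    have r [measurable]: "r \<in> measurable (prodM \<mu> {1..k}) (prodM \<mu> {i + 1..n})"
      unfolding r_def
      by (intro measurable_restrict measurable_component_singleton) (auto simp: k_def)
    have rS: "r x \<in> {i + 1..n} \<rightarrow>\<^sub>E space \<mu>" if "x \<in> Spow (space \<mu>) k" for x
      using measurable_space[OF r, of x] that by (simp add: space_PiM)
    have transport: "(\<integral>x. a (r x) \<partial>prodM \<mu> {1..k}) = (\<integral>x. a x \<partial>prodM \<mu> {i + 1..n})"
      if "a \<in> borel_measurable (prodM \<mu> {i + 1..n})" for a :: "_ \<Rightarrow> real"
      using integral_distr[OF r that] by (simp add: distr)
    define H where "H x = h (r x)" for x
    have h_meas [measurable]: "h \<in> borel_measurable (prodM \<mu> {i + 1..n})" using h_int by auto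
    have H_int: "integrable (prodM \<mu> {1..k}) H"
      unfolding H_def by (rule integrable_distr[OF r]) (simp add: distr h_int)
    have H_0: "(\<integral>x. H x \<partial>prodM \<mu> {1..k}) = 0"
      unfolding H_def by (subst transport) (simp_all add: h_0)
    have Psi: "Psi \<mu> k H \<le> (\<Sum>l<k. enn2real (eta \<mu> p n i (i + 1 + l) y w w'))"
    proof (rule Psi_le_sum[OF H_int])
      fix l A assume l: "l < k" and A [measurable]: "A \<in> sets (prodM \<mu> {1..k - l})"
      define j where "j = i + 1 + l"
      have win [measurable]: "window (i + l) (k - l) \<in> measurable (prodM \<mu> {j..n}) (prodM \<mu> {1..k - l})"
        using l k by (intro window_measurable) (auto simp: j_def)
      \<comment> \<open>\<open>A\<close> with its coordinates numbered from \<open>j\<close> on, an event for the conditional law of \<open>(X\<^sub>j, \<dots>, X\<^sub>n)\<close>\<close>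
      define A' where "A' = window (i + l) (k - l) -` A \<inter> space (prodM \<mu> {j..n})"
      have A' [measurable]: "A' \<in> sets (prodM \<mu> {j..n})" unfolding A'_def by measurable
      have res [measurable]: "(\<lambda>x. restrict x {j..n}) \<in> measurable (prodM \<mu> {i + 1..n}) (prodM \<mu> {j..n})"
        by (intro measurable_restrict_subset) (auto simp: j_def)
      have "(\<integral>x. H x * indicator A (window l (k - l) x) \<partial>prodM \<mu> {1..k})
          = (\<integral>x. (\<lambda>x. h x * indicator A' (restrict x {j..n})) (r x) \<partial>prodM \<mu> {1..k})"
      proof (rule Bochner_Integration.integral_cong[OF refl])
        fix x assume x: "x \<in> space (prodM \<mu> {1..k})"
        have "restrict (r x) {j..n} \<in> space (prodM \<mu> {j..n})"
          using measurable_space[OF res measurable_space[OF r x]] .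
        moreover have "window (i + l) (k - l) (restrict (r x) {j..n}) = window l (k - l) x"
          using l k by (auto simp: window_def r_def j_def fun_eq_iff)
        ultimately have "indicator A' (restrict (r x) {j..n}) = (indicator A (window l (k - l) x) :: real)"
          by (simp add: A'_def indicator_def)
        then show "H x * indicator A (window l (k - l) x) = (\<lambda>x. h x * indicator A' (restrict x {j..n})) (r x)"
          by (simp add: H_def)
      qed
      also have "\<dots> = (\<integral>x. h x * indicator A' (restrict x {j..n}) \<partial>prodM \<mu> {i + 1..n})"
        by (rule transport) measurable
      also have "\<dots> = measure (cond_law \<mu> p n i j (y(i := w))) A' - measure (cond_law \<mu> p n i j (y(i := w'))) A'"
      proof -
        have j': "i < j" by (simp add: j_def)
        have ind: "integrable (prodM \<mu> {i + 1..n}) (\<lambda>x. cond_dens i v x * indicator A' (restrict x {j..n}))"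
          if "regular i v" for v
          by (rule integrable_cond_dens_mult[OF i'(1) that, where C = 1]) (auto simp: indicator_def)
        show ?thesis
          unfolding measure_cond_law[OF i'(1) z j' A'] measure_cond_law[OF i'(1) z' j' A'] h_def
          by (subst Bochner_Integration.integral_diff[symmetric, OF ind[OF z] ind[OF z']])
             (simp add: left_diff_distrib)
      qed
      also have "\<dots> \<le> enn2real (eta \<mu> p n i j y w w')"
        by (rule cond_law_difference_le_eta) (use i' z z' A' in \<open>auto simp: j_def\<close>)
      finally show "(\<integral>x. H x * indicator A (window l (k - l) x) \<partial>prodM \<mu> {1..k})
          \<le> enn2real (eta \<mu> p n i (i + 1 + l) y w w')"
        by (simp add: j_def)
    qed
    define G where "G x = f (merge {1..i} {i + 1..n} (z, r x))" for x
    have mS: "merge {1..i} {i + 1..n} (z, r x) \<in> Spow (space \<mu>) n" if "x \<in> Spow (space \<mu>) k" for x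
      by (rule merge_in_Spow[OF i'(1) zS rS[OF that]])
    have G_lip: "\<bar>G x - G x'\<bar> \<le> L * \<rho> k x x'"
      if x: "x \<in> Spow (space \<mu>) k" and x': "x' \<in> Spow (space \<mu>) k" for x x'
    proof -
      have win: "window i (n - i) (merge {1..i} {i + 1..n} (z, r v)) = v"
        if "v \<in> Spow (space \<mu>) k" for v
        using that k by (auto simp: window_def merge_def r_def fun_eq_iff PiE_def extensional_def k_def)
      have "\<rho> n (merge {1..i} {i + 1..n} (z, r x)) (merge {1..i} {i + 1..n} (z, r x'))
          = \<rho> (n - i) x x'"
        using i k False by (subst dist_common_prefix[where a = i]) (auto simp: mS x x' win)
      then show ?thesis
        unfolding G_def using lipschitz[OF mS[OF x] mS[OF x']] by (simp add: k_def)
    qed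
    have Gb: "0 \<le> G x \<and> G x \<le> B" if "x \<in> Spow (space \<mu>) k" for x
      unfolding G_def by (rule f_bounds[OF mS[OF that]])
    have G_meas [measurable]: "G \<in> borel_measurable (prodM \<mu> {1..k})"
      unfolding G_def by measurable
    define c0 where "c0 = Inf (G ` Spow (space \<mu>) k)"
    \<comment> \<open>with infimum \<open>0\<close> and Lipschitz constant \<open>1\<close>, \<open>g\<close> stays below the diameter\<close>
    define g where "g x = (G x - c0) / L" for x
    have bdd: "bdd_below (G ` Spow (space \<mu>) k)" using Gb by (auto intro!: bdd_belowI[of _ 0])
    have g_Lip: "g \<in> Lip (Spow (space \<mu>) k) (\<rho> k)"
      unfolding Lip_def
    proof (intro CollectI conjI ballI)
      fix x assume x: "x \<in> Spow (space \<mu>) k"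
      have "c0 \<le> G x" unfolding c0_def using x by (intro cInf_lower bdd) auto
      then show g0: "0 \<le> g x" using L by (simp add: g_def)
      show "ereal (g x) \<le> ediam (Spow (space \<mu>) k) (\<rho> k)"
      proof (cases "ediam (Spow (space \<mu>) k) (\<rho> k)")
        case (real d)
        have d: "\<rho> k x x' \<le> d" if "x' \<in> Spow (space \<mu>) k" for x'
        proof -
          have "ereal (\<rho> k x x') \<le> ediam (Spow (space \<mu>) k) (\<rho> k)"
            unfolding ediam_def using x that by (intro SUP_upper2[of "(x, x')"]) auto
          then show ?thesis using real by simp
        qed
        have "G x - L * d \<le> c0"
          unfolding c0_def
        proof (rule cInf_greatest)
          fix v assume "v \<in> G ` Spow (space \<mu>) k"
          then obtain x' where x': "x' \<in> Spow (space \<mu>) k" "v = G x'" by auto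
          have "L * \<rho> k x x' \<le> L * d" using L d[OF x'(1)] by simp
          then show "G x - L * d \<le> v" using G_lip[OF x x'(1)] x'(2) by (simp add: abs_le_iff)
        qed (use x in auto)
        then have "g x \<le> d" using L by (simp add: g_def divide_le_eq algebra_simps)
        then show ?thesis using real by simp
      next
        case MInf
        have "ereal (\<rho> k x x) \<le> ediam (Spow (space \<mu>) k) (\<rho> k)"
          unfolding ediam_def using x by (intro SUP_upper2[of "(x, x)"]) auto
        then show ?thesis using MInf by simp
      qed simp
      fix x' assume x': "x' \<in> Spow (space \<mu>) k"
      have "\<bar>g x - g x'\<bar> = \<bar>G x - G x'\<bar> / L"
        using L by (simp add: g_def diff_divide_distrib[symmetric])
      also have "\<dots> \<le> \<rho> k x x'" using G_lip[OF x x'] L by (simp add: divide_le_eq mult.commute)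
      finally show "\<bar>g x - g x'\<bar> \<le> \<rho> k x x'" .
    qed
    have HG: "integrable (prodM \<mu> {1..k}) (\<lambda>x. H x * G x)"
    proof (rule Bochner_Integration.integrable_bound)
      show "integrable (prodM \<mu> {1..k}) (\<lambda>x. B * H x)" using H_int by simp
      show "AE x in prodM \<mu> {1..k}. norm (H x * G x) \<le> norm (B * H x)"
      proof (rule AE_I2)
        fix x assume "x \<in> space (prodM \<mu> {1..k})"
        then have "\<bar>G x\<bar> \<le> \<bar>B\<bar>" using Gb[of x] by (simp add: space_PiM)
        then show "norm (H x * G x) \<le> norm (B * H x)"
          by (auto simp: abs_mult mult.commute intro!: mult_right_mono)
      qed
    qed (use H_int in auto)
    have "(\<integral>x. h x * f (merge {1..i} {i + 1..n} (y(i := w), x)) \<partial>prodM \<mu> {i + 1..n})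
        = (\<integral>x. H x * G x \<partial>prodM \<mu> {1..k})"
      unfolding H_def G_def z_def[symmetric] by (rule transport[symmetric]) measurable
    also have "\<dots> = (\<integral>x. L * (H x * g x) + c0 * H x \<partial>prodM \<mu> {1..k})"
      using L by (intro Bochner_Integration.integral_cong) (auto simp: g_def field_simps)
    also have "\<dots> = L * (\<integral>x. H x * g x \<partial>prodM \<mu> {1..k}) + c0 * (\<integral>x. H x \<partial>prodM \<mu> {1..k})"
    proof -
      have "integrable (prodM \<mu> {1..k}) (\<lambda>x. (H x * G x - c0 * H x) / L)"
        using HG H_int by simp
      then have "integrable (prodM \<mu> {1..k}) (\<lambda>x. H x * g x)"
        by (simp add: g_def algebra_simps)
      then show ?thesis using H_int by simp
    qed
    also have "\<dots> \<le> L * Psi \<mu> k H"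
      using dominated[OF k(1) H_int g_Lip] L by (simp add: H_0)
    also have "\<dots> \<le> L * (\<Sum>l<k. enn2real (eta \<mu> p n i (i + 1 + l) y w w'))"
      using Psi L by simp
    also have "(\<Sum>l<k. enn2real (eta \<mu> p n i (i + 1 + l) y w w'))
        = (\<Sum>j\<in>{i + 1..n}. enn2real (eta \<mu> p n i j y w w'))"
      by (rule sum.reindex_bij_witness[where i = "\<lambda>j. j - (i + 1)" and j = "\<lambda>l. i + 1 + l"])
         (auto simp: k_def)
    finally show ?thesis .
  qed
qed

text \<open>Change the conditional law first and the value of \<open>X\<^sub>i\<close> second.  The first change is
  \<open>tail_variation\<close>; in the second, the two arguments of \<open>f\<close> differ in one coordinate, so \<open>f\<close> changes by at
  most \<open>L\<close>.\<close>

lemma oscillation: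
  assumes i: "i \<in> {1..n}" and z: "regular i (y(i := w))" and z': "regular i (y(i := w'))"
  shows "F i (y(i := w)) - F i (y(i := w'))
    \<le> L * (1 + (\<Sum>j\<in>{i + 1..n}. enn2real (eta \<mu> p n i j y w w')))"
proof -
  have i': "i \<le> n" using i by simp
  let ?M = "prodM \<mu> {i + 1..n}"
  let ?q = "cond_dens i (y(i := w))" and ?q' = "cond_dens i (y(i := w'))"
  let ?f = "\<lambda>x. f (merge {1..i} {i + 1..n} (y(i := w), x))"
  let ?f' = "\<lambda>x. f (merge {1..i} {i + 1..n} (y(i := w'), x))"
  note [measurable] = merge_regular_measurable[OF i' z] merge_regular_measurable[OF i' z']
  have mS: "merge {1..i} {i + 1..n} (v, x) \<in> Spow (space \<mu>) n" if "x \<in> space ?M" "regular i v" for v x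
    using that i' by (intro merge_in_Spow) (auto simp: regular_def space_PiM)
  have fb: "\<bar>?f x\<bar> \<le> B" "\<bar>?f' x\<bar> \<le> B" if "x \<in> space ?M" for x
    using f_bounds[OF mS[OF that z]] f_bounds[OF mS[OF that z']] by auto
  have close: "?f x - ?f' x \<le> L" if x: "x \<in> space ?M" for x
  proof -
    have "\<rho> n (merge {1..i} {i + 1..n} (y(i := w), x)) (merge {1..i} {i + 1..n} (y(i := w'), x)) \<le> 1"
      using i by (intro dist_one_coordinate[where i = i] mS x z z') (auto simp: merge_def)
    then have "L * \<rho> n (merge {1..i} {i + 1..n} (y(i := w), x)) (merge {1..i} {i + 1..n} (y(i := w'), x)) \<le> L * 1"
      using L by (intro mult_left_mono) auto
    then show ?thesis using lipschitz[OF mS[OF x z] mS[OF x z']] by (simp add: abs_le_iff)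
  qed
  note int = integrable_cond_dens_mult[OF i' z _ fb(1)] integrable_cond_dens_mult[OF i' z' _ fb(1)]
    integrable_cond_dens_mult[OF i' z' _ fb(2)]
  have int1: "integrable ?M (\<lambda>x. ?q x * ?f x)" by (rule int(1)) auto
  have int2: "integrable ?M (\<lambda>x. ?q' x * ?f x)" by (rule int(2)) auto
  have int3: "integrable ?M (\<lambda>x. ?q' x * ?f' x)" by (rule int(3)) auto
  have "F i (y(i := w)) - F i (y(i := w')) = (\<integral>x. ?q x * ?f x \<partial>?M) - (\<integral>x. ?q' x * ?f' x \<partial>?M)"
    by (simp add: F_eq_integral[OF i'] z z')
  also have "\<dots> = (\<integral>x. (?q x - ?q' x) * ?f x \<partial>?M) + (\<integral>x. ?q' x * (?f x - ?f' x) \<partial>?M)"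
    using int1 int2 int3 by (simp add: left_diff_distrib right_diff_distrib)
  finally have split: "F i (y(i := w)) - F i (y(i := w'))
      = (\<integral>x. (?q x - ?q' x) * ?f x \<partial>?M) + (\<integral>x. ?q' x * (?f x - ?f' x) \<partial>?M)" .
  have "(\<integral>x. ?q' x * (?f x - ?f' x) \<partial>?M) \<le> (\<integral>x. ?q' x * L \<partial>?M)"
  proof (rule integral_mono)
    show "integrable ?M (\<lambda>x. ?q' x * (?f x - ?f' x))"
      using int2 int3 by (simp add: right_diff_distrib)
    show "integrable ?M (\<lambda>x. ?q' x * L)"
      using integrable_cond_dens[OF i' z'] by simp
    show "?q' x * (?f x - ?f' x) \<le> ?q' x * L" if "x \<in> space ?M" for x
      by (rule mult_left_mono[OF close[OF that] cond_dens_nonneg])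
  qed
  then have "(\<integral>x. ?q' x * (?f x - ?f' x) \<partial>?M) \<le> L"
    using integral_cond_dens[OF i' z'] by simp
  with split tail_variation[OF i z z'] show ?thesis by (simp add: distrib_left)
qed

end

section \<open>Concentration\<close>

text \<open>The infimum defining an essential supremum is attained: take a sequence of bounds that converges
  to it, and the union of their exceptional null sets.\<close>

lemma eta_bar_attained:
  "\<exists>N\<in>null_sets (P i). \<forall>y\<in>Spow S (i - 1). \<forall>w\<in>S. \<forall>w'\<in>S.
     y(i := w) \<notin> N \<and> y(i := w') \<notin> N \<longrightarrow> eta \<mu> p n i j y w w' \<le> eta_bar S P \<mu> p n i j"
proof -
  define bounds where "bounds N a \<longleftrightarrow> (\<forall>y\<in>Spow S (i - 1). \<forall>w\<in>S. \<forall>w'\<in>S.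
     y(i := w) \<notin> N \<and> y(i := w') \<notin> N \<longrightarrow> eta \<mu> p n i j y w w' \<le> a)" for N a
  have bar: "eta_bar S P \<mu> p n i j = Inf {a. \<exists>N\<in>null_sets (P i). bounds N a}"
    by (simp add: eta_bar_def bounds_def)
  have "top \<in> {a. \<exists>N\<in>null_sets (P i). bounds N a}"
    by (auto simp: bounds_def intro!: bexI[of _ "{}"])
  then have ne: "{a. \<exists>N\<in>null_sets (P i). bounds N a} \<noteq> {}" by blast
  obtain a :: "nat \<Rightarrow> ennreal" where a: "range a \<subseteq> {a. \<exists>N\<in>null_sets (P i). bounds N a}"
    and inf: "eta_bar S P \<mu> p n i j = (INF l. a l)"
    using ennreal_Inf_countable_INF[OF ne] unfolding bar by auto
  from a have "\<forall>l. \<exists>N\<in>null_sets (P i). bounds N (a l)" by auto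
  then obtain N where N: "\<And>l. N l \<in> null_sets (P i)" "\<And>l. bounds (N l) (a l)" by metis
  have "bounds (\<Union>l. N l) (eta_bar S P \<mu> p n i j)"
    unfolding bounds_def inf using N(2) by (auto simp: bounds_def intro!: INF_greatest)
  moreover have "(\<Union>l. N l) \<in> null_sets (P i)" using N(1) by auto
  ultimately show ?thesis unfolding bounds_def by blast
qed

lemma row_sum_le_linf_opnorm_Delta:
  assumes i: "i \<in> {1..n}"
  shows "1 + (\<Sum>j\<in>{i + 1..n}. enn2real (eta_bar S P \<mu> p n i j)) \<le> linf_opnorm n (Delta S P \<mu> p n)"
proof -
  let ?D = "\<lambda>j. \<bar>Delta S P \<mu> p n i j\<bar>"
  have "1 + (\<Sum>j\<in>{i + 1..n}. enn2real (eta_bar S P \<mu> p n i j)) = ?D i + (\<Sum>j\<in>{i + 1..n}. ?D j)"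
    by (simp add: Delta_def)
  also have "\<dots> = (\<Sum>j\<in>insert i {i + 1..n}. ?D j)"
    by simp
  also have "\<dots> \<le> (\<Sum>j\<in>{1..n}. ?D j)"
    using i by (intro sum_mono2) auto
  also have "\<dots> \<le> (MAX i\<in>{1..n}. \<Sum>j\<in>{1..n}. \<bar>Delta S P \<mu> p n i j\<bar>)"
    using i by (intro Max_ge) auto
  also have "\<dots> = linf_opnorm n (Delta S P \<mu> p n)"
    using i by (intro linf_opnorm_eq_Max_row_sum[symmetric]) auto
  finally show ?thesis .
qed

text \<open>For a set \<open>A\<close> of finite positive measure and the constant function \<open>d x y\<close>, dominance says
  \<open>d x y * \<mu>(A) \<le> \<Psi>\<^sub>1(1\<^sub>A) = \<mu>(A)\<close>.\<close>

lemma (in power_measure) diam_le_1: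
  assumes metric: "Metric_space (Spow (space \<mu>) 1) d"
    and nontrivial: "emeasure (prodM \<mu> {1..1}) (space (prodM \<mu> {1..1})) \<noteq> 0"
    and dominated: "\<And>H g. \<lbrakk>integrable (prodM \<mu> {1..1}) H; g \<in> Lip (Spow (space \<mu>) 1) d\<rbrakk> \<Longrightarrow>
      (\<integral>x. H x * g x \<partial>prodM \<mu> {1..1}) \<le> Psi \<mu> 1 H"
    and x: "x \<in> Spow (space \<mu>) 1" and y: "y \<in> Spow (space \<mu>) 1"
  shows "d x y \<le> 1"
proof -
  let ?M = "prodM \<mu> {1..1}"
  interpret M: sigma_finite_measure ?M by (rule sigma_finite_prodM) simp
  interpret Metric_space "Spow (space \<mu>) 1" d by fact
  obtain W :: "nat \<Rightarrow> (nat \<Rightarrow> 'a) set" where W: "range W \<subseteq> sets ?M" "(\<Union>l. W l) = space ?M"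
    "\<And>l. emeasure ?M (W l) \<noteq> \<infinity>"
    using M.sigma_finite by blast
  have "\<exists>l. emeasure ?M (W l) \<noteq> 0"
  proof (rule ccontr)
    assume "\<not> ?thesis"
    then have "W l \<in> null_sets ?M" for l using W(1) by (auto simp: null_sets_def)
    then have "(\<Union>l. W l) \<in> null_sets ?M" by auto
    then show False using nontrivial W(2) by (simp add: null_sets_def)
  qed
  then obtain l where l: "emeasure ?M (W l) \<noteq> 0" by blast
  define A where "A = W l"
  have A: "A \<in> sets ?M" "emeasure ?M A < \<infinity>" "emeasure ?M A \<noteq> 0"
    using W(1) W(3)[of l] l by (auto simp: A_def less_top)
  have pos: "0 < measure ?M A" using A by (simp add: measure_def enn2real_positive_iff zero_less_iff_neq_zero)
  have int: "integrable ?M (indicator A :: _ \<Rightarrow> real)" using A by simp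
  have "(\<lambda>_. d x y) \<in> Lip (Spow (space \<mu>) 1) d"
    unfolding Lip_def ediam_def using x y by (auto intro!: SUP_upper2[of "(x, y)"])
  then have "(\<integral>v. indicator A v * d x y \<partial>?M) \<le> Psi \<mu> 1 (indicator A)"
    by (rule dominated[OF int])
  moreover have "(\<integral>v. indicator A v * d x y \<partial>?M) = d x y * measure ?M A"
    using A sets.sets_into_space[OF A(1)] by (simp add: Int_absorb2)
  moreover have "Psi \<mu> 1 (indicator A) = measure ?M A"
  proof -
    have "max (indicator A v) 0 = (indicator A v :: real)" for v by (simp add: indicator_def)
    moreover have "Psi \<mu> 1 H = (\<integral>v. max (H v) 0 \<partial>?M)" for H
      by (simp add: One_nat_def)
    ultimately show ?thesis
      using sets.sets_into_space[OF A(1)] by (simp add: Int_absorb2)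
  qed
  ultimately have "d x y * measure ?M A \<le> 1 * measure ?M A" by linarith
  then show ?thesis using pos by (simp only: mult_le_cancel_right_pos)
qed

theorem theorem7p1:
  fixes n :: nat
    and S :: "'a set"
    and \<rho> :: "nat \<Rightarrow> (nat \<Rightarrow> 'a) \<Rightarrow> (nat \<Rightarrow> 'a) \<Rightarrow> real"
    and P :: "nat \<Rightarrow> (nat \<Rightarrow> 'a) measure"
    and \<mu> :: "'a measure"
    and p :: "(nat \<Rightarrow> 'a) \<Rightarrow> ennreal"
    and f :: "(nat \<Rightarrow> 'a) \<Rightarrow> real"
    and t :: real
  assumes "1 \<le> n"
    and "metric_prob_family n S \<rho> P"
    and "space \<mu> = S"
    and "sigma_finite_measure \<mu>"
    and "Psi_dominated n S \<rho> \<mu>"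
    and "p \<in> borel_measurable (prodM \<mu> {1..n})"
    and "P n = density (prodM \<mu> {1..n}) p"
    and "is_lipschitz (Spow S n) (\<rho> n) f"
    and "0 < t"
  shows "measure (P n) {x \<in> space (P n). \<bar>f x - (\<integral>x. f x \<partial>P n)\<bar> > t} \<le>
    (if lip_norm (Spow S n) (\<rho> n) f = 0 then 0
     else 2 * exp (- (t\<^sup>2 / (2 * real n * (lip_norm (Spow S n) (\<rho> n) f)\<^sup>2
                              * (linf_opnorm n (Delta S P \<mu> p n))\<^sup>2))))"
proof -
  interpret power_measure \<mu> using assms(4) by (simp add: power_measure_def)
  have n: "n \<in> {1..n}" using assms(1) by simp
  have S_metric: "Metric_space (Spow S k) (\<rho> k)" and P_prob: "prob_space (P k)"
    and P_space: "space (P k) = Spow S k" and P_borel: "sets (P k) = sets (metric_borel (Spow S k) (\<rho> k))"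
    if "k \<in> {1..n}" for k
    using assms(2) that by (auto simp: metric_prob_family_def)
  have marginal: "P (k - 1) = distr (P k) (P (k - 1)) (\<lambda>x. restrict x {1..k - 1})" if "k \<in> {2..n}" for k
    using assms(2) that unfolding metric_prob_family_def by blast
  have deletion: "\<rho> k x y = \<rho> (k - 1) (del_coord k i x) (del_coord k i y)"
    if "k \<in> {2..n}" "i \<in> {1..k}" "x \<in> Spow S k" "y \<in> Spow S k" "x i = y i" for k i x y
    using assms(5) that unfolding Psi_dominated_def by blast
  have borel: "sets (prodM \<mu> {1..k}) = sets (metric_borel (Spow S k) (\<rho> k))" if "k \<in> {1..n}" for k
    using assms(5) that unfolding Psi_dominated_def by blast
  have dominated: "(\<integral>x. H x * g x \<partial>prodM \<mu> {1..k}) \<le> Psi \<mu> k H"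
    if "k \<in> {1..n}" "integrable (prodM \<mu> {1..k}) H" "g \<in> Lip (Spow S k) (\<rho> k)" for k H g
  proof -
    have "ereal (\<integral>x. H x * g x \<partial>prodM \<mu> {1..k})
        \<le> (SUP g\<in>Lip (Spow S k) (\<rho> k). ereal (\<integral>x. H x * g x \<partial>prodM \<mu> {1..k}))"
      using that(3) by (rule SUP_upper)
    also have "\<dots> \<le> ereal (Psi \<mu> k H)"
      using assms(5) that unfolding Psi_dominated_def by blast
    finally have "ereal (\<integral>x. H x * g x \<partial>prodM \<mu> {1..k}) \<le> ereal (Psi \<mu> k H)" .
    then show ?thesis by simp
  qed
  interpret Pn: prob_space "P n" by (rule P_prob[OF n])
  have p_prob: "(\<integral>\<^sup>+x. p x \<partial>prodM \<mu> {1..n}) = 1"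
  proof -
    have "emeasure (P n) (space (P n)) = (\<integral>\<^sup>+x. p x * indicator (space (prodM \<mu> {1..n})) x \<partial>prodM \<mu> {1..n})"
      unfolding assms(7) using assms(6) by (subst emeasure_density) auto
    also have "\<dots> = (\<integral>\<^sup>+x. p x \<partial>prodM \<mu> {1..n})"
      by (rule nn_integral_cong) simp
    finally show ?thesis by (simp add: Pn.emeasure_space_1)
  qed
  interpret coordinate_density \<mu> n p
    by unfold_locales (use assms(6) p_prob in auto)
  have law: "P i = law i" if "i \<in> {1..n}" for i
  proof -
    have "i \<le> n" using that by simp
    then show ?thesis using that
    proof (induction rule: inc_induct)
      case base
      show ?case by (simp add: law_full assms(7))
    next
      case (step i)
      have "P i = distr (P (Suc i)) (P i) (\<lambda>x. restrict x {1..i})"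
        using marginal[of "Suc i"] step by simp
      also have "\<dots> = distr (law (Suc i)) (prodM \<mu> {1..i}) (\<lambda>x. restrict x {1..i})"
        using step P_borel borel by (intro distr_cong) auto
      also have "\<dots> = law i" using law_pred[of "Suc i"] step by simp
      finally show ?case .
    qed
  qed
  have nontrivial: "emeasure (prodM \<mu> {1..1}) (space (prodM \<mu> {1..1})) \<noteq> 0"
  proof
    assume *: "emeasure (prodM \<mu> {1..1}) (space (prodM \<mu> {1..1})) = 0"
    have one: "1 \<in> {1..n}" using assms(1) by simp
    have "AE x in prodM \<mu> {1..1}. False"
      using * by (intro AE_I'[where N = "space (prodM \<mu> {1..1})"]) (auto simp: null_sets_def)
    then have "(\<integral>\<^sup>+x. m 1 x \<partial>prodM \<mu> {1..1}) = (\<integral>\<^sup>+x. 0 \<partial>prodM \<mu> {1..1})"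
      by (intro nn_integral_cong_AE) auto
    then show False
      using nn_integral_marg_density[OF p_measurable, of 1] p_prob assms(1) by simp
  qed
  have diam: "\<rho> 1 x y \<le> 1" if "x \<in> Spow S 1" "y \<in> Spow S 1" for x y
    by (rule diam_le_1[OF _ nontrivial, unfolded assms(3), OF S_metric dominated])
       (use assms(1) that in auto)
  interpret deletion_metrics n "space \<mu>" \<rho>
    by (rule deletion_metrics.intro; unfold assms(3)) (fact S_metric, fact deletion, rule diam)
  let ?X = "Spow S n"
  define L where "L = lip_norm ?X (\<rho> n) f"
  have lip: "\<bar>f x - f y\<bar> \<le> L * \<rho> n x y" if "x \<in> ?X" "y \<in> ?X" for x y
    unfolding L_def by (rule lip_norm_bound[OF S_metric[OF n] assms(8) that])
  have L0: "0 \<le> L" unfolding L_def by (rule lip_norm_nonneg[OF assms(8)])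
  have "f \<in> borel_measurable (metric_borel ?X (\<rho> n))"
    by (rule lipschitz_borel_measurable[OF S_metric[OF n] lip])
  then have f_meas: "f \<in> borel_measurable (prodM \<mu> {1..n})"
    using measurable_cong_sets[OF borel[OF n] refl, of borel] by blast
  then have f_measP [measurable]: "f \<in> borel_measurable (P n)" by (simp add: assms(7))
  obtain x0 where x0: "x0 \<in> ?X" using Pn.not_empty P_space[OF n] by auto
  have f_bd: "\<bar>f x - f x0\<bar> \<le> L * n" if "x \<in> ?X" for x
  proof -
    have "L * \<rho> n x x0 \<le> L * n"
      using dist_le[OF n] that x0 assms(3) L0 by (intro mult_left_mono) auto
    then show ?thesis using lip[OF that x0] by linarith
  qed
  \<comment> \<open>a nonnegative bounded translate of \<open>f\<close>; centring removes the translation\<close>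
  define f0 where "f0 x = f x - f x0 + L * n" for x
  have f0_bd: "0 \<le> f0 x \<and> f0 x \<le> 2 * L * n" if "x \<in> ?X" for x
    using f_bd[OF that] by (simp add: f0_def abs_le_iff)
  have f_int: "integrable (P n) f"
  proof (rule Pn.integrable_const_bound)
    show "AE x in P n. norm (f x) \<le> \<bar>f x0\<bar> + L * n"
    proof (rule AE_I2)
      fix x assume "x \<in> space (P n)"
      then show "norm (f x) \<le> \<bar>f x0\<bar> + L * n"
        using f_bd[of x] P_space[OF n] by (simp add: abs_le_iff) linarith
    qed
  qed simp
  have centred: "f0 x - (\<integral>x. f0 x \<partial>P n) = f x - (\<integral>x. f x \<partial>P n)" for x
    using f_int by (simp add: f0_def Pn.prob_space)
  \<comment> \<open>for \<open>L = 0\<close> the function is constant, and there is no deviation at all\<close>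
  show ?thesis
  proof (cases "L = 0")
    case True
    have const: "f x = f x0" if "x \<in> ?X" for x
      using lip[OF that x0] True by simp
    then have "(\<integral>x. f x \<partial>P n) = (\<integral>x. f x0 \<partial>P n)"
      using P_space[OF n] by (intro Bochner_Integration.integral_cong) auto
    then have "(\<integral>x. f x \<partial>P n) = f x0" by (simp add: Pn.prob_space)
    then have empty: "{x \<in> space (P n). \<bar>f x - (\<integral>x. f x \<partial>P n)\<bar> > t} = {}"
      using const P_space[OF n] assms(9) by auto
    show ?thesis unfolding empty L_def[symmetric] using True by simp
  next
    case False
    then have L: "0 < L" using L0 by simp
    interpret dominated_observable \<mu> n p f0 "2 * L * n" \<rho> L
    proof unfold_locales
      show "f0 \<in> borel_measurable (prodM \<mu> {1..n})" unfolding f0_def using f_meas by measurable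
      show "0 \<le> f0 x \<and> f0 x \<le> 2 * L * real n" if "x \<in> Spow (space \<mu>) n" for x
        using f0_bd that assms(3) by simp
      show "\<bar>f0 x - f0 y\<bar> \<le> L * \<rho> n x y" if "x \<in> Spow (space \<mu>) n" "y \<in> Spow (space \<mu>) n" for x y
        using lip that assms(3) by (simp add: f0_def)
      show "(\<integral>x. H x * g x \<partial>prodM \<mu> {1..k}) \<le> Psi \<mu> k H"
        if "k \<in> {1..n}" "integrable (prodM \<mu> {1..k}) H" "g \<in> Lip (Spow (space \<mu>) k) (\<rho> k)" for k H g
        using dominated that assms(3) by simp
    qed (rule L)
    let ?D = "linf_opnorm n (Delta S P \<mu> p n)"
    define c where "c = L * ?D"
    have D1: "1 \<le> ?D"
    proof -
      have "1 \<le> 1 + (\<Sum>j\<in>{1 + 1..n}. enn2real (eta_bar S P \<mu> p n 1 j))"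
        by (simp add: sum_nonneg)
      also have "\<dots> \<le> ?D" by (rule row_sum_le_linf_opnorm_Delta) (use assms(1) in simp)
      finally show ?thesis .
    qed
    then have c: "0 < c" using L by (simp add: c_def)
    define Z where "Z i = {z \<in> space (law i). \<not> (0 < m i z \<and> m i z \<noteq> \<infinity>)}" for i
    have Z: "Z i \<in> null_sets (law i)" if "i \<in> {1..n}" for i
    proof -
      have [measurable]: "m i \<in> borel_measurable (law i)"
        using m_measurable[of i] that by (simp add: law_def)
      have "Z i \<in> sets (law i)" unfolding Z_def by measurable
      moreover have "AE z in law i. z \<notin> Z i"
        using AE_law[of i] that by (intro eventually_mono[OF AE_law]) (auto simp: Z_def)
      ultimately show ?thesis by (simp add: AE_iff_null_sets)
    qed
    have reg: "regular i (y(i := w))"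
      if "i \<in> {1..n}" "y \<in> Spow S (i - 1)" "w \<in> S" "y(i := w) \<notin> Z i" for i y w
    proof -
      have "y(i := w) \<in> Spow S i"
        using that(1-3) by (auto simp: PiE_iff extensional_def)
      then show ?thesis
        using that(4) assms(3) by (auto simp: Z_def regular_def law_def space_PiM zero_less_iff_neq_zero)
    qed
    have bar_1: "eta_bar S P \<mu> p n i j \<le> 1" if i: "i \<in> {1..n}" and j: "i < j" for i j
      unfolding eta_bar_def
      using Z[OF i] law[OF i] eta_le_1[OF j] reg[OF i] i
      by (intro Inf_lower CollectI bexI[of _ "Z i"]) auto
    define exceptional where "exceptional i j N \<longleftrightarrow> (\<forall>y\<in>Spow S (i - 1). \<forall>w\<in>S. \<forall>w'\<in>S.
        y(i := w) \<notin> N \<and> y(i := w') \<notin> N \<longrightarrow> eta \<mu> p n i j y w w' \<le> eta_bar S P \<mu> p n i j)" for i j N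
    have "\<exists>N\<in>null_sets (P i). exceptional i j N" for i j
      unfolding exceptional_def by (rule eta_bar_attained)
    then obtain E where E: "\<And>i j. E i j \<in> null_sets (P i)" "\<And>i j. exceptional i j (E i j)"
      by metis
    have eta_le: "eta \<mu> p n i j y w w' \<le> eta_bar S P \<mu> p n i j"
      if "y \<in> Spow S (i - 1)" "w \<in> S" "w' \<in> S" "y(i := w) \<notin> E i j" "y(i := w') \<notin> E i j" for i j y w w'
      using E(2)[of i j, unfolded exceptional_def] that by simp
    \<comment> \<open>away from this null set the conditional laws exist and all \<open>\<eta>\<^sub>i\<^sub>j\<close> are bounded by their essential suprema\<close>
    define N where "N i = Z i \<union> (\<Union>j. E i j)" for i
    have N: "N i \<in> null_sets (law i)" if "i \<in> {1..n}" for i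
      unfolding N_def using Z[OF that] E(1)[of i] law[OF that] by auto
    have one_sided: "F i (y(i := w)) - F i (y(i := w')) \<le> c"
      if i: "i \<in> {1..n}" and y: "y \<in> Spow S (i - 1)" and w: "w \<in> S" "w' \<in> S"
        and good: "y(i := w) \<notin> N i" "y(i := w') \<notin> N i" for i y w w'
    proof -
      have r: "regular i (y(i := w))" "regular i (y(i := w'))"
        using reg[OF i y] w good by (auto simp: N_def)
      have "enn2real (eta \<mu> p n i j y w w') \<le> enn2real (eta_bar S P \<mu> p n i j)" if "j \<in> {i + 1..n}" for j
      proof (rule enn2real_mono)
        show "eta \<mu> p n i j y w w' \<le> eta_bar S P \<mu> p n i j"
          using good by (intro eta_le y w) (auto simp: N_def)
        show "eta_bar S P \<mu> p n i j < top"
          using bar_1[OF i, of j] that by (simp add: le_less_trans)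
      qed
      then have "(\<Sum>j\<in>{i + 1..n}. enn2real (eta \<mu> p n i j y w w'))
          \<le> (\<Sum>j\<in>{i + 1..n}. enn2real (eta_bar S P \<mu> p n i j))"
        by (rule sum_mono)
      then have "1 + (\<Sum>j\<in>{i + 1..n}. enn2real (eta \<mu> p n i j y w w')) \<le> ?D"
        using row_sum_le_linf_opnorm_Delta[OF i, of S P \<mu> p] by linarith
      then have "L * (1 + (\<Sum>j\<in>{i + 1..n}. enn2real (eta \<mu> p n i j y w w'))) \<le> c"
        unfolding c_def using L by simp
      then show ?thesis using oscillation[OF i r] by linarith
    qed
    have mgf: "(\<integral>\<^sup>+x. exp (l * (f x - (\<integral>x. f x \<partial>P n))) \<partial>P n) \<le> ennreal (exp (l\<^sup>2 * (real n * c\<^sup>2) / 2))" for l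
    proof -
      have "(\<integral>\<^sup>+x. exp (l * (f0 x - (\<integral>x. f0 x \<partial>law n))) \<partial>law n) \<le> ennreal (exp (l\<^sup>2 * (real n * c\<^sup>2) / 2))"
      proof (rule mgf_bound[OF N])
        fix i y w w'
        assume *: "i \<in> {1..n}" "y \<in> Spow (space \<mu>) (i - 1)" "w \<in> space \<mu>" "w' \<in> space \<mu>"
          "y(i := w) \<notin> N i" "y(i := w') \<notin> N i"
        show "\<bar>F i (y(i := w)) - F i (y(i := w'))\<bar> \<le> c"
          using one_sided[of i y w w'] one_sided[of i y w' w] * assms(3) by (simp add: abs_le_iff)
      qed
      then show ?thesis unfolding law[OF n, symmetric] centred .
    qed
    have "measure (P n) {x \<in> space (P n). \<bar>f x - (\<integral>x. f x \<partial>P n)\<bar> > t}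
        \<le> 2 * exp (- (t\<^sup>2 / (2 * (real n * c\<^sup>2))))"
      using c assms(1,9) by (intro Pn.subgaussian_tail mgf) auto
    also have "2 * (real n * c\<^sup>2) = 2 * real n * L\<^sup>2 * ?D\<^sup>2"
      by (simp add: c_def power_mult_distrib)
    finally show ?thesis using False by (simp add: L_def)
  qed
qed

end
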